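(* Let $n\in\mathbb{N}\cup\{0\}$, $\tau\in(0,+\infty)$, $x_0\in\mathbb{R}^d$, and let $f:[0,(n+1)\tau]\times\mathbb{R}^d\times\mathbb{R}^d\to\mathbb{R}^d$ satisfy the following assumptions: (A1) $f(t,\cdot,\cdot)\in C(\mathbb{R}^d\times\mathbb{R}^d;\mathbb{R}^d)$ for all $t\in[0,(n+1)\tau]$; (A2) $f(\cdot,x,z)$ is Borel measurable for all $(x,z)\in\mathbb{R}^d\times\mathbb{R}^d$; (A3' with $p=+\infty$, $\alpha=1$) there exist $\bar K,L:[0,(n+1)\tau]\to[0,+\infty)$ with $\bar K,L\in L^\infty([0,(n+1)\tau])$ such that for all $t\in[0,(n+1)\tau]$ $$\|f(t,0,0)\|\le\bar K(t),$$ and for all $t\in[0,(n+1)\tau]$, $x_1,x_2,z_1,z_2\in\mathbb{R}^d$ $$\|f(t,x_1,z_1)-f(t,x_2,z_2)\|\le L(t)\bigl(\|x_1-x_2\|+\|z_1-z_2\|\bigr).$$ Let $x$ be the solution of the delay differential equation $$x'(t)=f(t,x(t),x(t-\tau)),\quad t\in[0,(n+1)\tau],\qquad x(t)=x_0,\quad t\in[-\tau,0),$$ and for $N\in\mathbb{N}$ let $h=\tau/N$, $t_i^j=j\tau+ih$, and let $y_i^j$ ($0\le i\le N$, $0\le j\le n$) be the output of the randomized Euler scheme with discretization parameter $N$. Then for all $\varepsilon\in(0,1/2)$ there exists a random variable $\tilde\eta_{\varepsilon,n}\in\bigcap_{q\in[2,+\infty)}L^q(\Omega)$ such that $$\max_{0\le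 j\le n}\max_{0\le i\le N}\|x(t_i^j)-y_i^j\|\le\tilde\eta_{\varepsilon,n}\cdot N^{-\frac12+\varepsilon}\quad\text{almost surely}$$ for all $N\ge\lceil\tau\rceil$.
   Context: $\|\cdot\|$ is the Euclidean norm on $\mathbb{R}^d$. $(\Omega,\Sigma,\mathbb{P})$ is a complete probability space, and $L^q(\Omega)$ is the space of real random variables $X$ with $\|X\|_{L^q(\Omega)}=(\mathbb{E}|X|^q)^{1/q}<+\infty$. Solution: the unique absolutely continuous function $x:[-\tau,(n+1)\tau]\to\mathbb{R}^d$ with $x(t)=x_0$ for $t\in[-\tau,0]$ and $x'(t)=f(t,x(t),x(t-\tau))$ for almost every $t\in[0,(n+1)\tau]$ (it exists and is unique under the stated assumptions). Randomized Euler scheme: let $\{\gamma_k^j\}_{j\in\mathbb{N}_0,k\in\mathbb{N}}$ be i.i.d. random variables on $(\Omega,\Sigma,\mathbb{P})$, each uniformly distributed on $[0,1]$. For $N\in\mathbb{N}$ put $h=\tau/N$, $t_k^j=j\tau+kh$ for $k=0,\ldots,N$, $j=0,\ldots,n$, and $\theta_{k+1}^j=t_k^j+h\gamma_{k+1}^j$. Set $y_0^{-1}=\cdots=y_N^{-1}=x_0$, and for $j=0,1,\ldots,n$, $k=0,1,\ldots,N-1$ $$y_0^j=y_N^{j-1},\qquad y_{k+1}^j=y_k^j+h\,f(\theta_{k+1}^j,y_k^j,y_k^{j-1}).$$ The $y_k^j$ depend on $N$; the random variable $\tilde\eta_{\varepsilon,n}$ does not. *)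

theory Defs
  imports "HOL-Probability.Probability"
begin

(* Intended for an interval I. Degenerate pairs a i = b i are harmless: they contribute 0 to
   both sums. *)
definition abs_continuous_on :: "real set \<Rightarrow> (real \<Rightarrow> 'a::real_normed_vector) \<Rightarrow> bool" where
  "abs_continuous_on I x \<longleftrightarrow>
     (\<forall>\<epsilon>>0. \<exists>\<delta>>0. \<forall>(m::nat) a b.
        (\<forall>i<m. a i \<le> b i \<and> {a i..b i} \<subseteq> I) \<and>
        disjoint_family_on (\<lambda>i. {a i<..<b i}) {..<m} \<and>
        (\<Sum>i<m. b i - a i) < \<delta> \<longrightarrow>
        (\<Sum>i<m. norm (x (b i) - x (a i))) < \<epsilon>)"

definition Linfty :: "'a measure \<Rightarrow> ('a \<Rightarrow> real) set" where
  "Linfty M = {g \<in> borel_measurable M. esssup M (\<lambda>x. ereal \<bar>g x\<bar>) < \<infinity>}"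

definition Lq :: "'a measure \<Rightarrow> real \<Rightarrow> ('a \<Rightarrow> real) set" where
  "Lq M q = {X \<in> borel_measurable M. integrable M (\<lambda>\<omega>. \<bar>X \<omega>\<bar> powr q)}"

(* T stands for (n+1) * tau. The right-hand side f and the bounds K, L are total functions,
   but only their values for times in {0..T} are constrained. *)

definition cond_A1 :: "real \<Rightarrow> (real \<Rightarrow> real^'d \<Rightarrow> real^'d \<Rightarrow> real^'d) \<Rightarrow> bool" where
  "cond_A1 T f \<longleftrightarrow> (\<forall>t\<in>{0..T}. continuous_on UNIV (\<lambda>(x, z). f t x z))"

definition cond_A2 :: "real \<Rightarrow> (real \<Rightarrow> real^'d \<Rightarrow> real^'d \<Rightarrow> real^'d) \<Rightarrow> bool" where
  "cond_A2 T f \<longleftrightarrow>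
     (\<forall>x z. (\<lambda>t. f t x z) \<in> borel_measurable (restrict_space borel {0..T}))"

definition cond_A3 :: "real \<Rightarrow> (real \<Rightarrow> real^'d \<Rightarrow> real^'d \<Rightarrow> real^'d) \<Rightarrow> bool" where
  "cond_A3 T f \<longleftrightarrow>
     (\<exists>K L :: real \<Rightarrow> real.
        (\<forall>t\<in>{0..T}. 0 \<le> K t \<and> 0 \<le> L t) \<and>
        K \<in> Linfty (lebesgue_on {0..T}) \<and> L \<in> Linfty (lebesgue_on {0..T}) \<and>
        (\<forall>t\<in>{0..T}. norm (f t 0 0) \<le> K t) \<and>
        (\<forall>t\<in>{0..T}. \<forall>x1 x2 z1 z2.
           norm (f t x1 z1 - f t x2 z2) \<le> L t * (norm (x1 - x2) + norm (z1 - z2))))"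

definition dde_solution ::
  "nat \<Rightarrow> real \<Rightarrow> real^'d \<Rightarrow> (real \<Rightarrow> real^'d \<Rightarrow> real^'d \<Rightarrow> real^'d) \<Rightarrow> (real \<Rightarrow> real^'d) \<Rightarrow> bool" where
  "dde_solution n \<tau> x0 f x \<longleftrightarrow>
     abs_continuous_on {-\<tau>..(real n + 1) * \<tau>} x \<and>
     (\<forall>t\<in>{-\<tau>..0}. x t = x0) \<and>
     (AE t in lebesgue_on {0..(real n + 1) * \<tau>}.
        (x has_vector_derivative f t (x t) (x (t - \<tau>))) (at t within {-\<tau>..(real n + 1) * \<tau>}))"

definition grid_point :: "real \<Rightarrow> nat \<Rightarrow> nat \<Rightarrow> nat \<Rightarrow> real" where
  "grid_point \<tau> N j k = real j * \<tau> + real k * (\<tau> / real N)"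

(* The argument g is one realization of the family (gamma_k^j), read as g j k.
   The first index is shifted by one: euler_stage ... 0 k is y_k^(-1), and
   euler_stage ... (Suc j) k is y_k^j. *)
fun euler_stage ::
  "real \<Rightarrow> real^'d \<Rightarrow> (real \<Rightarrow> real^'d \<Rightarrow> real^'d \<Rightarrow> real^'d) \<Rightarrow> nat \<Rightarrow> (nat \<Rightarrow> nat \<Rightarrow> real)
     \<Rightarrow> nat \<Rightarrow> nat \<Rightarrow> real^'d" where
  "euler_stage \<tau> x0 f N g 0 k = x0"
| "euler_stage \<tau> x0 f N g (Suc j) 0 = euler_stage \<tau> x0 f N g j N"
| "euler_stage \<tau> x0 f N g (Suc j) (Suc k) =
     euler_stage \<tau> x0 f N g (Suc j) k
     + (\<tau> / real N) *\<^sub>R f (grid_point \<tau> N j k + (\<tau> / real N) * g j (Suc k))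
         (euler_stage \<tau> x0 f N g (Suc j) k) (euler_stage \<tau> x0 f N g j k)"

definition rand_euler ::
  "real \<Rightarrow> real^'d \<Rightarrow> (real \<Rightarrow> real^'d \<Rightarrow> real^'d \<Rightarrow> real^'d) \<Rightarrow> nat \<Rightarrow> (nat \<Rightarrow> nat \<Rightarrow> real)
     \<Rightarrow> nat \<Rightarrow> nat \<Rightarrow> real^'d" where
  "rand_euler \<tau> x0 f N g j k = euler_stage \<tau> x0 f N g (Suc j) k"

(* gamma_k^j is indexed by j = 0, 1, 2, ... and k = 1, 2, ...; gamma j 0 is unconstrained. *)
definition iid_uniform :: "'w measure \<Rightarrow> (nat \<Rightarrow> nat \<Rightarrow> 'w \<Rightarrow> real) \<Rightarrow> bool" where
  "iid_uniform M \<gamma> \<longleftrightarrow>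
     prob_space.indep_vars M (\<lambda>_. borel) (\<lambda>(j, k). \<gamma> j k) (UNIV \<times> {1..}) \<and>
     (\<forall>j. \<forall>k\<ge>1. distr M borel (\<gamma> j k) = uniform_measure lborel {0..1})"

end

(* Writing m = j N + k, the error v of the scheme satisfies
     v (m+1) = v m + Z m + h R m,  norm (R m) <= c h + L (norm (v m) + norm (v (m - N))),
   where Z m is the difference of the integral of x' over a step and its one-point Monte Carlo
   estimate, so that the discrete Gronwall lemma bounds v by h plus the largest partial sum of Z.
   The Z m are independent, centred and of size h; by Hoeffding's lemma exp (sqrt N |S|) has, for
   each component S of each partial sum, an expectation bounded uniformly in N. Hence
   W = (sum over N of N^-3 times the sum of all these exponentials) is integrable, and almost surely
   sqrt N |S| <= 3 ln N + ln (1 + W) for all N. As ln (1 + W) lies in every L^q, it yields eta. *)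
theory Submission
  imports Defs
begin

subsection \<open>Absolutely continuous functions\<close>

text \<open>In time, \<open>f\<close> is only measurable and essentially bounded, so a quadrature
  with fixed nodes need not converge; a uniformly random node makes every one-step estimate
  unbiased. Comparing with \<open>x'\<close> at the node, and not with \<open>f\<close> at the
  numerical values, makes \<open>Z m\<close> a function of a single uniform variable: hence true
  independence, not merely a martingale structure. Only partial sums of \<open>Z\<close> may enter
  the Gronwall argument, since norms of order h over about N steps would add up to order one. The
  maximum over partial sums is handled by a union bound: order N pairs of a partial sum and a
  component, with weight N^-3, leave a convergent series of N^-2. The price is \<open>ln N\<close>,
  which N^\<epsilon> absorbs; the gain is one W for all N, so that \<eta> does not depend on N. The
  other obstacle is that the derivative and the bounds on \<open>f\<close> are available almost
  everywhere only. This forces the fundamental theorem for absolutely continuous functions, a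
  bounded Borel version of \<open>x'\<close>, and the remark that random nodes almost surely avoid a
  given null set.\<close>

lemma abs_continuous_on_finite:
  fixes x :: "real \<Rightarrow> 'a::real_normed_vector"
  assumes "abs_continuous_on I x" "e > 0"
  shows "\<exists>d>0. \<forall>(P :: 'b set) a b. finite P \<longrightarrow> (\<forall>i\<in>P. a i \<le> b i \<and> {a i..b i} \<subseteq> I) \<longrightarrow>
       disjoint_family_on (\<lambda>i. {a i<..<b i}) P \<longrightarrow> (\<Sum>i\<in>P. b i - a i) < d \<longrightarrow>
       (\<Sum>i\<in>P. norm (x (b i) - x (a i))) < e"
proof -
  obtain d where "d > 0" and d: "\<And>(m::nat) a b. (\<forall>i<m. a i \<le> b i \<and> {a i..b i} \<subseteq> I) \<Longrightarrow>
        disjoint_family_on (\<lambda>i. {a i<..<b i}) {..<m} \<Longrightarrow>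
        (\<Sum>i<m. b i - a i) < d \<Longrightarrow> (\<Sum>i<m. norm (x (b i) - x (a i))) < e"
    using assms unfolding abs_continuous_on_def by meson
  show ?thesis
  proof (intro exI conjI allI impI)
    show "d > 0" by fact
    fix P :: "'b set" and a b
    assume fin: "finite P" and sub: "\<forall>i\<in>P. a i \<le> b i \<and> {a i..b i} \<subseteq> I"
      and dj: "disjoint_family_on (\<lambda>i. {a i<..<b i}) P" and less: "(\<Sum>i\<in>P. b i - a i) < d"
    \<comment> \<open>The definition numbers its intervals, while tagged divisions are sets of
      pairs; an enumeration of \<open>P\<close> carries one form into the other.\<close>
    obtain h where h: "bij_betw h {..<card P} P"
      using ex_bij_betw_nat_finite[OF fin] by (auto simp: atLeast0LessThan)
    have mem: "h i \<in> P" if "i < card P" for i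
      using h that by (auto simp: bij_betw_def)
    have "(\<Sum>i<card P. norm (x ((b \<circ> h) i) - x ((a \<circ> h) i))) < e"
    proof (rule d)
      show "\<forall>i<card P. (a \<circ> h) i \<le> (b \<circ> h) i \<and> {(a \<circ> h) i..(b \<circ> h) i} \<subseteq> I"
        using mem sub by auto
      show "disjoint_family_on (\<lambda>i. {(a \<circ> h) i<..<(b \<circ> h) i}) {..<card P}"
        unfolding disjoint_family_on_def
      proof (intro ballI impI)
        fix i j assume ij: "i \<in> {..<card P}" "j \<in> {..<card P}" "i \<noteq> j"
        then have "h i \<noteq> h j"
          using h by (auto simp: bij_betw_def inj_on_def)
        then show "{(a \<circ> h) i<..<(b \<circ> h) i} \<inter> {(a \<circ> h) j<..<(b \<circ> h) j} = {}"
          using disjoint_family_onD[OF dj mem mem, of i j] ij by simp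
      qed
      show "(\<Sum>i<card P. (b \<circ> h) i - (a \<circ> h) i) < d"
        using less sum.reindex_bij_betw[OF h, of "\<lambda>i. b i - a i"] by simp
    qed
    then show "(\<Sum>i\<in>P. norm (x (b i) - x (a i))) < e"
      using sum.reindex_bij_betw[OF h, of "\<lambda>i. norm (x (b i) - x (a i))"] by simp
  qed
qed

lemma abs_continuous_on_subset:
  "abs_continuous_on I x \<Longrightarrow> J \<subseteq> I \<Longrightarrow> abs_continuous_on J x"
  unfolding abs_continuous_on_def by (meson subset_trans)

lemma abs_continuous_on_imp_continuous_on:
  fixes x :: "real \<Rightarrow> 'a::real_normed_vector"
  assumes "abs_continuous_on {a..b} x"
  shows "continuous_on {a..b} x"
  unfolding continuous_on_iff
proof (intro ballI allI impI)
  fix s e :: real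
  assume s: "s \<in> {a..b}" and "e > 0"
  obtain d where "d > 0" and d: "\<forall>(P::unit set) a' b'. finite P \<longrightarrow>
       (\<forall>i\<in>P. a' i \<le> b' i \<and> {a' i..b' i} \<subseteq> {a..b}) \<longrightarrow>
       disjoint_family_on (\<lambda>i. {a' i<..<b' i}) P \<longrightarrow> (\<Sum>i\<in>P. b' i - a' i) < d \<longrightarrow>
       (\<Sum>i\<in>P. norm (x (b' i) - x (a' i))) < e"
    using abs_continuous_on_finite[OF assms \<open>e > 0\<close>] by blast
  have "dist (x t) (x s) < e" if t: "t \<in> {a..b}" "dist t s < d" for t
  proof -
    have "norm (x (max s t) - x (min s t)) < e"
      using d[rule_format, of "{()}" "\<lambda>_. min s t" "\<lambda>_. max s t"] s t
      by (auto simp: disjoint_family_on_def dist_real_def)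
    then show ?thesis
      by (cases "s \<le> t") (auto simp: dist_norm norm_minus_commute max_def min_def)
  qed
  then show "\<exists>d>0. \<forall>t\<in>{a..b}. dist t s < d \<longrightarrow> dist (x t) (x s) < e"
    using \<open>d > 0\<close> by blast
qed

text \<open>The gauge confines the division intervals tagged in the null set \<open>N\<close> to an open set of measure
  less than \<open>\<delta>\<close>, where absolute continuity makes the increments of \<open>x\<close> small; elsewhere the
  usual Henstock--Kurzweil argument applies.\<close>
lemma fundamental_theorem_of_calculus_abs_continuous:
  fixes x :: "real \<Rightarrow> 'a::banach"
  assumes ac: "abs_continuous_on {a..b} x" and "a \<le> b" and N: "negligible N"
    and der: "\<And>t. t \<in> {a..b} - N \<Longrightarrow> (x has_vector_derivative g t) (at t within {a..b})"
  shows "(g has_integral x b - x a) {a..b}"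
proof -
  \<comment> \<open>Tags in \<open>N\<close> then have no Riemann term, so their error is exactly an
    increment of \<open>x\<close>; changing \<open>g\<close> on a negligible set leaves the integral
    alone.\<close>
  define g' where "g' t = (if t \<in> N then 0 else g t)" for t
  have "(g' has_integral x b - x a) {a..b}"
    unfolding has_integral_real
  proof (intro allI impI)
    fix e :: real assume "e > 0"
    \<comment> \<open>The \<open>+ 1\<close> covers \<open>a = b\<close> and makes
      \<open>e1 * (b - a) < e / 2\<close> strict.\<close>
    define e1 where "e1 = e / 2 / (b - a + 1)"
    have "e1 > 0" using \<open>e > 0\<close> \<open>a \<le> b\<close> by (simp add: e1_def)
    have e1: "e1 * (b - a) < e / 2"
      using \<open>e > 0\<close> \<open>a \<le> b\<close> by (simp add: e1_def field_simps)
    obtain \<delta> where "\<delta> > 0" and \<delta>: "\<forall>(P::(real \<times> real set) set) a' b'. finite P \<longrightarrow>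
       (\<forall>i\<in>P. a' i \<le> b' i \<and> {a' i..b' i} \<subseteq> {a..b}) \<longrightarrow>
       disjoint_family_on (\<lambda>i. {a' i<..<b' i}) P \<longrightarrow> (\<Sum>i\<in>P. b' i - a' i) < \<delta> \<longrightarrow>
       (\<Sum>i\<in>P. norm (x (b' i) - x (a' i))) < e / 2"
      using abs_continuous_on_finite[OF ac half_gt_zero[OF \<open>e > 0\<close>]] by blast
    have Nnull: "N \<in> null_sets lebesgue" using N by (simp add: negligible_iff_null_sets)
    obtain U where U: "open U" "N \<subseteq> U" "emeasure lebesgue (U - N) < ennreal \<delta>"
      using sets_lebesgue_outer_open[OF null_setsD2[OF Nnull] \<open>\<delta> > 0\<close>] by metis
    have "emeasure lebesgue U = emeasure lebesgue (U - N)"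
      using emeasure_Diff_null_set[OF Nnull, of U] U(1) by (simp add: borel_open)
    then have Um: "emeasure lborel U < ennreal \<delta>"
      using U(1,3) by (simp add: borel_open)
    have "\<exists>d>0. (t \<in> N \<longrightarrow> ball t d \<subseteq> U) \<and> (t \<in> {a..b} - N \<longrightarrow>
         (\<forall>y\<in>{a..b}. norm (y-t) < d \<longrightarrow> norm (x y - x t - (y-t) *\<^sub>R g t) \<le> e1 * norm (y-t)))" for t
    proof (cases "t \<in> N")
      case True
      then show ?thesis using U openE by blast
    next
      case False
      show ?thesis
      proof (cases "t \<in> {a..b}")
        case True
        then show ?thesis
          using der[of t] False \<open>e1 > 0\<close>
          unfolding has_vector_derivative_def has_derivative_within_alt by auto
      next
        case outside: False
        then show ?thesis using False by (auto intro: exI[of _ 1])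
      qed
    qed
    then obtain d where dpos: "\<And>t. d t > 0" and dN: "\<And>t. t \<in> N \<Longrightarrow> ball t (d t) \<subseteq> U"
      and d: "\<And>t y. t \<in> {a..b} - N \<Longrightarrow> y \<in> {a..b} \<Longrightarrow> norm (y-t) < d t \<Longrightarrow>
           norm (x y - x t - (y-t) *\<^sub>R g t) \<le> e1 * norm (y-t)"
      by metis
    show "\<exists>\<gamma>. gauge \<gamma> \<and> (\<forall>D. D tagged_division_of {a..b} \<and> \<gamma> fine D \<longrightarrow>
             norm ((\<Sum>(t,k)\<in>D. measure lborel k *\<^sub>R g' t) - (x b - x a)) < e)"
    proof (intro exI conjI allI impI)
      show "gauge (\<lambda>t. ball t (d t))" using dpos gauge_ball_dependent by blast
      fix p assume "p tagged_division_of {a..b} \<and> (\<lambda>t. ball t (d t)) fine p"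
      then have p: "p tagged_division_of cbox a b" and finep: "(\<lambda>t. ball t (d t)) fine p"
        by auto
      have K: "Inf K \<le> Sup K \<and> K = {Inf K..Sup K} \<and> t \<in> K \<and> K \<subseteq> {a..b} \<and> K \<subseteq> ball t (d t)"
        if "(t, K) \<in> p" for t K
      proof -
        obtain u v where "K = cbox u v"
          using tagged_division_ofD(4)[OF p \<open>(t, K) \<in> p\<close>] by blast
        moreover have "t \<in> K" "K \<subseteq> cbox a b" using p \<open>(t, K) \<in> p\<close> by blast+
        moreover have "K \<subseteq> ball t (d t)" using finep \<open>(t, K) \<in> p\<close> by (meson fineD)
        ultimately show ?thesis by auto
      qed
      have cont: "measure lborel K = Sup K - Inf K" if "(t, K) \<in> p" for t K
        using K[OF that] by (metis content_real)
      have "finite p" using p by blast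
      define P where "P = {q \<in> p. fst q \<in> N}"
      have P: "P \<subseteq> p" "finite P" using \<open>finite p\<close> by (auto simp: P_def)
      define err where "err q = measure lborel (snd q) *\<^sub>R g' (fst q) - (x (Sup (snd q)) - x (Inf (snd q)))" for q
      have tot: "(\<Sum>(t,k)\<in>p. measure lborel k *\<^sub>R g' t) - (x b - x a) = (\<Sum>q\<in>p. err q)"
        using additive_tagged_division_1[of a b p x] \<open>a \<le> b\<close> p
        by (simp add: err_def sum_subtractf split_def)
      have dj: "disjoint_family_on (\<lambda>q. {Inf (snd q)<..<Sup (snd q)}) p"
        unfolding disjoint_family_on_def
      proof (intro ballI impI)
        fix q r assume "q \<in> p" "r \<in> p" "q \<noteq> r"
        then have "interior (snd q) \<inter> interior (snd r) = {}"
          using tagged_division_ofD(5)[OF p] by (metis prod.collapse)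
        moreover have "interior (snd s) = {Inf (snd s)<..<Sup (snd s)}" if "s \<in> p" for s
          using K[of "fst s" "snd s"] that by (metis interior_atLeastAtMost_real prod.collapse)
        ultimately show "{Inf (snd q)<..<Sup (snd q)} \<inter> {Inf (snd r)<..<Sup (snd r)} = {}"
          using \<open>q \<in> p\<close> \<open>r \<in> p\<close> by metis
      qed
      have "(\<Sum>q\<in>P. norm (err q)) < e / 2"
      proof -
        have djP: "disjoint_family_on (\<lambda>q. {Inf (snd q)<..<Sup (snd q)}) P"
          using dj P(1) by (rule disjoint_family_on_mono[rotated])
        have KP: "Inf (snd q) \<le> Sup (snd q) \<and> snd q = {Inf (snd q)..Sup (snd q)} \<and> snd q \<subseteq> {a..b} \<and> snd q \<subseteq> U"
          if "q \<in> P" for q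
          using K[of "fst q" "snd q"] dN[of "fst q"] that by (auto simp: P_def)
        have "ennreal (\<Sum>q\<in>P. Sup (snd q) - Inf (snd q)) = (\<Sum>q\<in>P. emeasure lborel {Inf (snd q)<..<Sup (snd q)})"
          using KP by (subst sum_ennreal[symmetric]) (auto intro!: sum.cong)
        also have "\<dots> = emeasure lborel (\<Union>q\<in>P. {Inf (snd q)<..<Sup (snd q)})"
          by (rule sum_emeasure) (use djP P in auto)
        also have "\<dots> \<le> emeasure lborel U"
        proof (rule emeasure_mono)
          show "(\<Union>q\<in>P. {Inf (snd q)<..<Sup (snd q)}) \<subseteq> U"
          proof (rule UN_least)
            fix q assume "q \<in> P"
            have "{Inf (snd q)<..<Sup (snd q)} \<subseteq> {Inf (snd q)..Sup (snd q)}" by auto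
            then show "{Inf (snd q)<..<Sup (snd q)} \<subseteq> U" using KP[OF \<open>q \<in> P\<close>] by blast
          qed
        qed (use U in auto)
        finally have "ennreal (\<Sum>q\<in>P. Sup (snd q) - Inf (snd q)) < ennreal \<delta>"
          using Um by (rule le_less_trans)
        then have small: "(\<Sum>q\<in>P. Sup (snd q) - Inf (snd q)) < \<delta>"
          using \<open>\<delta> > 0\<close> by (meson ennreal_leI linorder_not_le)
        have "(\<Sum>q\<in>P. norm (x (Sup (snd q)) - x (Inf (snd q)))) < e / 2"
          using KP by (intro \<delta>[rule_format] P djP small) metis
        moreover have "norm (err q) = norm (x (Sup (snd q)) - x (Inf (snd q)))" if "q \<in> P" for q
          using that by (simp add: err_def P_def g'_def norm_minus_commute)
        ultimately show ?thesis by simp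
      qed
      moreover have "(\<Sum>q\<in>p - P. norm (err q)) \<le> e1 * (b - a)"
      proof -
        have "norm (err q) \<le> e1 * (Sup (snd q) - Inf (snd q))" if "q \<in> p - P" for q
        proof -
          define t u v where tuv: "t = fst q" "u = Inf (snd q)" "v = Sup (snd q)"
          have q: "(t, snd q) \<in> p" "t \<notin> N" using that by (auto simp: P_def tuv)
          have uv: "u \<le> v" "snd q = {u..v}" "t \<in> {u..v}" "{u..v} \<subseteq> {a..b}" "{u..v} \<subseteq> ball t (d t)"
            using K[OF q(1)] unfolding tuv by auto
          have "u \<in> {u..v}" "v \<in> {u..v}" using uv(1) by auto
          then have "u \<in> ball t (d t)" "v \<in> ball t (d t)"
            by (auto dest: subsetD[OF uv(5)] simp del: mem_ball atLeastAtMost_iff)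
          then have near: "norm (u - t) < d t" "norm (v - t) < d t"
            by (simp_all only: mem_ball dist_norm norm_minus_commute)
          have "err q = (v - u) *\<^sub>R g t - (x v - x u)"
            using cont[OF q(1)] q(2) by (simp add: err_def g'_def tuv)
          \<comment> \<open>Straddle estimate: both endpoints are compared with the tag
            \<open>t\<close>. As \<open>t\<close> lies between \<open>u\<close> and
            \<open>v\<close>, the two distances add up to \<open>v - u\<close>.\<close>
          then have "err q = (x u - x t - (u - t) *\<^sub>R g t) - (x v - x t - (v - t) *\<^sub>R g t)"
            by (simp add: algebra_simps)
          then have "norm (err q) \<le> norm (x u - x t - (u - t) *\<^sub>R g t) + norm (x v - x t - (v - t) *\<^sub>R g t)"
            by (simp only: norm_triangle_ineq4)
          also have "\<dots> \<le> e1 * norm (u - t) + e1 * norm (v - t)"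
            using uv q(2) near by (intro add_mono d) auto
          also have "\<dots> = e1 * (v - u)" using uv(3) by (simp add: algebra_simps)
          finally show ?thesis by (simp add: tuv)
        qed
        then have "(\<Sum>q\<in>p - P. norm (err q)) \<le> (\<Sum>q\<in>p - P. e1 * (Sup (snd q) - Inf (snd q)))"
          by (rule sum_mono)
        also have "\<dots> \<le> (\<Sum>q\<in>p. e1 * (Sup (snd q) - Inf (snd q)))"
          using \<open>finite p\<close> \<open>e1 > 0\<close> K by (intro sum_mono2) auto
        also have "\<dots> = e1 * (b - a)"
          using additive_tagged_division_1[of a b p "\<lambda>x. x"] \<open>a \<le> b\<close> p
          by (simp add: sum_distrib_left[symmetric] split_def)
        finally show ?thesis .
      qed
      moreover have "norm (\<Sum>q\<in>p. err q) \<le> (\<Sum>q\<in>P. norm (err q)) + (\<Sum>q\<in>p - P. norm (err q))"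
        using sum_norm_le[of p err "\<lambda>q. norm (err q)"] sum.subset_diff[OF P(1) \<open>finite p\<close>, of "\<lambda>q. norm (err q)"]
        by simp
      ultimately show "norm ((\<Sum>(t,k)\<in>p. measure lborel k *\<^sub>R g' t) - (x b - x a)) < e"
        unfolding tot using e1 by linarith
    qed
  qed
  then show ?thesis
    using N by (rule has_integral_spike[rotated 2]) (auto simp: g'_def)
qed

text \<open>Rounding the time inside \<open>x\<close> to multiples of \<open>1 / Suc i\<close>
  leaves countably many second arguments of \<open>f\<close>, each giving a measurable function of
  \<open>t\<close>. Continuity of \<open>x\<close> and then of \<open>f t\<close> identifies the
  limit.\<close>

lemma borel_measurable_caratheodory:
  fixes f :: "real \<Rightarrow> 'a::metric_space \<Rightarrow> 'b::metric_space"
  assumes cont: "\<And>t. t \<in> {0..T} \<Longrightarrow> continuous_on UNIV (f t)"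
    and meas: "\<And>y. (\<lambda>t. f t y) \<in> borel_measurable (restrict_space borel {0..T})"
    and x: "continuous_on {0..T} x"
  shows "(\<lambda>t. f t (x t)) \<in> borel_measurable (restrict_space borel {0..T})"
proof (rule borel_measurable_LIMSEQ_metric)
  let ?r = "\<lambda>(i::nat) t. of_int \<lfloor>real (Suc i) * t\<rfloor> / real (Suc i) :: real"
  show "(\<lambda>t. f t (x (?r i t))) \<in> borel_measurable (restrict_space borel {0..T})" for i
  proof (rule measurable_compose_countable[where f = "\<lambda>k t. f t (x (of_int k / real (Suc i)))"])
    have "(\<lambda>t. \<lfloor>real (Suc i) * t\<rfloor>) \<in> borel \<rightarrow>\<^sub>M (count_space UNIV :: int measure)"
      by measurable
    then show "(\<lambda>t. \<lfloor>real (Suc i) * t\<rfloor>) \<in> restrict_space borel {0..T} \<rightarrow>\<^sub>M count_space UNIV"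
      by (rule measurable_restrict_space1)
  qed (rule meas)
  fix t assume "t \<in> space (restrict_space borel {0..T})"
  then have t: "t \<in> {0..T}" by (simp add: space_restrict_space)
  \<comment> \<open>Rounding down, unlike rounding to the nearest multiple, cannot leave
    \<open>{0..T}\<close>, where \<open>x\<close> is known to be continuous.\<close>
  have in_T: "?r i t \<in> {0..T}" for i
  proof -
    have "?r i t \<le> t"
      using of_int_floor_le[of "real (Suc i) * t"] by (simp add: field_simps)
    moreover have "0 \<le> ?r i t" using t by simp
    ultimately show ?thesis using t by auto
  qed
  have "(\<lambda>i. ?r i t) \<longlonglongrightarrow> t"
  proof (rule LIM_zero_cancel, rule LIMSEQ_norm_0)
    fix i show "norm (?r i t - t) < 1 / real (Suc i)"
    proof -
      have "\<bar>of_int \<lfloor>real (Suc i) * t\<rfloor> - real (Suc i) * t\<bar> < 1"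
        by linarith
      moreover have "?r i t - t = (of_int \<lfloor>real (Suc i) * t\<rfloor> - real (Suc i) * t) / real (Suc i)"
        by (simp add: diff_divide_distrib)
      ultimately show ?thesis
        by (simp only: real_norm_def abs_divide divide_strict_right_mono abs_of_nat of_nat_0_less_iff zero_less_Suc)
    qed
  qed
  then have "(\<lambda>i. x (?r i t)) \<longlonglongrightarrow> x t"
    using x t in_T by (intro continuous_on_tendsto_compose[OF x]) auto
  then show "(\<lambda>i. f t (x (?r i t))) \<longlonglongrightarrow> f t (x t)"
    by (intro continuous_on_tendsto_compose[OF cont[OF t]]) auto
qed

subsection \<open>Regularity of the solution\<close>

lemma Linfty_AE_bounded:
  assumes "g \<in> Linfty M"
  obtains c where "c \<ge> 0" "AE t in M. \<bar>g t\<bar> \<le> c"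
proof -
  have fin: "esssup M (\<lambda>x. ereal \<bar>g x\<bar>) < \<infinity>" using assms by (simp add: Linfty_def)
  obtain c where "esssup M (\<lambda>x. ereal \<bar>g x\<bar>) \<le> ereal c" 
    using fin by (cases "esssup M (\<lambda>x. ereal \<bar>g x\<bar>)") auto
  then have "AE t in M. ereal \<bar>g t\<bar> \<le> ereal c"
    by (intro eventually_mono[OF esssup_AE[where M = M and f = "\<lambda>x. ereal \<bar>g x\<bar>"]]) (rule order_trans)
  then have "AE t in M. \<bar>g t\<bar> \<le> max 0 c" by (auto elim!: eventually_mono)
  then show thesis by (intro that[of "max 0 c"]) auto
qed

text \<open>\<open>G\<close> is the set of times at which the essential bounds hold; \<open>g\<close> is a version of \<open>x'\<close> that
  is Borel measurable and bounded everywhere.\<close>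
lemma dde_solution_regularity:
  fixes f :: "real \<Rightarrow> real^'d \<Rightarrow> real^'d \<Rightarrow> real^'d" and x :: "real \<Rightarrow> real^'d"
  assumes T_def: "T = (real n + 1) * \<tau>"
    and \<tau>: "0 < \<tau>" and A1: "cond_A1 (T) f" and A2: "cond_A2 (T) f" and A3: "cond_A3 (T) f"
    and sol: "dde_solution n \<tau> x0 f x"
  obtains G g C \<Lambda> where "C \<ge> 0" "\<Lambda> \<ge> 0" "AE t in lborel. t \<in> {0..T} \<longrightarrow> t \<in> G"
    "g \<in> borel_measurable borel" "\<forall>t. norm (g t) \<le> C"
    "\<forall>t\<in>G. g t = f t (x t) (x (t - \<tau>))"
    "\<forall>t\<in>G. \<forall>x1 x2 z1 z2. norm (f t x1 z1 - f t x2 z2) \<le> \<Lambda> * (norm (x1 - x2) + norm (z1 - z2))"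
    "\<forall>a b. 0 \<le> a \<longrightarrow> a \<le> b \<longrightarrow> b \<le> T \<longrightarrow> (g has_integral x b - x a) {a..b}"
    "\<forall>s\<in>{-\<tau>..T}. \<forall>t\<in>{-\<tau>..T}. norm (x s - x t) \<le> C * \<bar>s - t\<bar>"
proof -
  have "T > 0" using \<tau> by (simp add: T_def)
  have ac: "abs_continuous_on {-\<tau>..T} x" and x0: "\<And>t. t \<in> {-\<tau>..0} \<Longrightarrow> x t = x0"
    and der: "AE t in lebesgue_on {0..T}. (x has_vector_derivative f t (x t) (x (t - \<tau>))) (at t within {-\<tau>..T})"
    using sol unfolding dde_solution_def T_def[symmetric] by auto
  obtain K L where KL: "K \<in> Linfty (lebesgue_on {0..T})" "L \<in> Linfty (lebesgue_on {0..T})"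
    and K: "\<And>t. t \<in> {0..T} \<Longrightarrow> norm (f t 0 0) \<le> K t"
    and L: "\<And>t x1 x2 z1 z2. t \<in> {0..T} \<Longrightarrow>
        norm (f t x1 z1 - f t x2 z2) \<le> L t * (norm (x1 - x2) + norm (z1 - z2))"
    using A3 unfolding cond_A3_def by blast
  obtain \<kappa> where \<kappa>: "\<kappa> \<ge> 0" "AE t in lebesgue_on {0..T}. \<bar>K t\<bar> \<le> \<kappa>" by (rule Linfty_AE_bounded[OF KL(1)])
  obtain \<Lambda> where \<Lambda>: "\<Lambda> \<ge> 0" "AE t in lebesgue_on {0..T}. \<bar>L t\<bar> \<le> \<Lambda>" by (rule Linfty_AE_bounded[OF KL(2)])
  have x_cont: "continuous_on {-\<tau>..T} x" by (rule abs_continuous_on_imp_continuous_on[OF ac])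
  then have "bounded (x ` {-\<tau>..T})"
    by (intro compact_imp_bounded compact_continuous_image) auto
  then obtain b where b: "\<And>t. t \<in> {-\<tau>..T} \<Longrightarrow> norm (x t) \<le> b" unfolding bounded_iff by blast
  have "b \<ge> 0" using order_trans[OF norm_ge_zero b[of 0]] \<tau> \<open>T > 0\<close> by simp
  \<comment> \<open>A bound for \<open>f\<close> along the solution: its size at zero plus the
    Lipschitz constant times the two state arguments, each of norm at most \<open>b\<close> by
    compactness.\<close>
  define C where "C = \<kappa> + \<Lambda> * (b + b)"
  have "C \<ge> 0" using \<open>b \<ge> 0\<close> \<kappa> \<Lambda> by (simp add: C_def)
  define \<phi> where "\<phi> t = f t (x t) (x (t - \<tau>))" for t
  define \<psi> where "\<psi> t = indicator {0..T} t *\<^sub>R \<phi> t" for t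
  \<comment> \<open>Truncation keeps Borel measurability and changes nothing on \<open>G\<close>.
    With a bound at every time, the quadrature errors are bounded at every sample point.\<close>
  define g where "g t = (if norm (\<psi> t) \<le> C then \<psi> t else 0)" for t
  define G where "G = {t \<in> {0..T}. norm (\<phi> t) \<le> C \<and> L t \<le> \<Lambda>}"
  have "(\<lambda>t. case_prod (f t) (x t, x (t - \<tau>))) \<in> borel_measurable (restrict_space borel {0..T})"
  proof (rule borel_measurable_caratheodory[where f = "\<lambda>t. case_prod (f t)" and x = "\<lambda>t. (x t, x (t - \<tau>))"])
    show "continuous_on UNIV (case_prod (f t))" if "t \<in> {0..T}" for t
      using A1 that by (simp add: cond_A1_def)
    show "(\<lambda>t. case_prod (f t) y) \<in> borel_measurable (restrict_space borel {0..T})" for y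
      using A2 by (cases y) (simp add: cond_A2_def)
    show "continuous_on {0..T} (\<lambda>t. (x t, x (t - \<tau>)))"
      using \<tau> \<open>T > 0\<close>
      by (intro continuous_on_Pair continuous_on_compose2[OF x_cont] continuous_intros) auto
  qed
  then have [measurable]: "\<psi> \<in> borel_measurable borel"
    unfolding \<psi>_def \<phi>_def by (subst borel_measurable_restrict_space_iff[symmetric]) auto
  have g_meas: "g \<in> borel_measurable borel" unfolding g_def by measurable
  have g_bound: "norm (g t) \<le> C" for t using \<open>C \<ge> 0\<close> by (simp add: g_def)
  have g_eq: "g t = \<phi> t" if "t \<in> G" for t using that by (auto simp: g_def \<psi>_def G_def)
  have f_lip: "norm (f t x1 z1 - f t x2 z2) \<le> \<Lambda> * (norm (x1 - x2) + norm (z1 - z2))" if "t \<in> G" for t x1 x2 z1 z2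
  proof -
    have "norm (f t x1 z1 - f t x2 z2) \<le> L t * (norm (x1 - x2) + norm (z1 - z2))"
      using that L by (simp add: G_def)
    also have "\<dots> \<le> \<Lambda> * (norm (x1 - x2) + norm (z1 - z2))"
      using that by (intro mult_right_mono) (auto simp: G_def)
    finally show ?thesis .
  qed
  have "AE t in lebesgue_on {0..T}. t \<in> {0..T} \<longrightarrow> t \<in> G \<and> (x has_vector_derivative \<phi> t) (at t within {-\<tau>..T})"
    using \<kappa>(2) \<Lambda>(2) der
  proof eventually_elim
    case (elim t)
    have "norm (\<phi> t) \<le> C" if t: "t \<in> {0..T}"
    proof -
      have "norm (\<phi> t) \<le> norm (f t 0 0) + norm (f t (x t) (x (t - \<tau>)) - f t 0 0)"
        unfolding \<phi>_def by (metis norm_triangle_sub)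
      also have "\<dots> \<le> K t + L t * (norm (x t - 0) + norm (x (t - \<tau>) - 0))"
        by (intro add_mono K[OF t] L[OF t])
      also have "\<dots> \<le> \<kappa> + \<Lambda> * (b + b)"
      proof (intro add_mono mult_mono)
        show "norm (x t - 0) \<le> b" "norm (x (t - \<tau>) - 0) \<le> b"
          using b[of t] b[of "t - \<tau>"] t \<tau> by auto
      qed (use elim \<Lambda> in auto)
      finally show ?thesis by (simp add: C_def)
    qed
    then show ?case using elim by (auto simp: G_def \<phi>_def)
  qed
  \<comment> \<open>The statement moves from completed Lebesgue measure to \<open>lborel\<close>,
    with which the laws of the random nodes are compared.\<close>
  then have AE_G: "AE t in lborel. t \<in> {0..T} \<longrightarrow> t \<in> G \<and> (x has_vector_derivative \<phi> t) (at t within {-\<tau>..T})"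
    by (simp add: AE_restrict_space_iff AE_completion_iff)
  then obtain N where N: "N \<in> null_sets lborel"
    and N_good: "\<And>t. t \<in> {0..T} - N \<Longrightarrow> t \<in> G \<and> (x has_vector_derivative \<phi> t) (at t within {-\<tau>..T})"
    by (auto elim!: AE_E3)
  have g_int: "(g has_integral x b - x a) {a..b}" if "0 \<le> a" "a \<le> b" "b \<le> T" for a b
  proof (rule fundamental_theorem_of_calculus_abs_continuous)
    have sub: "{a..b} \<subseteq> {-\<tau>..T}" using that \<tau> by auto
    show "abs_continuous_on {a..b} x" by (rule abs_continuous_on_subset[OF ac sub])
    show "negligible N" using N by (simp add: negligible_iff_null_sets null_sets_completionI)
    fix t assume "t \<in> {a..b} - N"
    then show "(x has_vector_derivative g t) (at t within {a..b})"
      using N_good[of t] that g_eq by (auto intro: has_vector_derivative_within_subset[OF _ sub])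
  qed fact
  have lip0: "norm (x t - x s) \<le> C * (t - s)" if "0 \<le> s" "s \<le> t" "t \<le> T" for s t
    using has_integral_bound_real[OF \<open>C \<ge> 0\<close> finite.emptyI g_int[OF that]] g_bound that by simp
  \<comment> \<open>\<open>x\<close> is constant on the history and \<open>max 0\<close> is
    1-Lipschitz, so the Lipschitz bound extends to negative times, where delayed arguments may
    lie.\<close>
  have ext: "x t = x (max 0 t)" if "t \<in> {-\<tau>..T}" for t
    using x0[of t] x0[of 0] that \<tau> by (auto simp: max_def)
  have lip: "norm (x s - x t) \<le> C * \<bar>s - t\<bar>" if "s \<in> {-\<tau>..T}" "t \<in> {-\<tau>..T}" for s t
  proof -
    have "norm (x (max 0 s) - x (max 0 t)) \<le> C * \<bar>max 0 s - max 0 t\<bar>"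
    proof (cases "s \<le> t")
      case True
      then show ?thesis
        using lip0[of "max 0 s" "max 0 t"] that \<open>T > 0\<close>
        by (auto simp: norm_minus_commute max_def split: if_splits)
    next
      case False
      then show ?thesis
        using lip0[of "max 0 t" "max 0 s"] that \<open>T > 0\<close> by (auto simp: max_def split: if_splits)
    qed
    also have "\<dots> \<le> C * \<bar>s - t\<bar>" using \<open>C \<ge> 0\<close> by (intro mult_left_mono) auto
    finally show ?thesis using ext that by simp
  qed
  show thesis
    by (rule that[of C \<Lambda> G g])
      (use \<open>C \<ge> 0\<close> \<Lambda>(1) AE_G g_meas g_bound g_eq f_lip g_int lip in \<open>auto simp: \<phi>_def\<close>)
qed

subsection \<open>Error recursion of the randomized Euler scheme\<close>

text \<open>The recursion is summed before norms are taken, so that cancellation in \<open>Z\<close>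
  survives. The inductive bound \<open>D * \<rho> ^ m\<close> is nondecreasing in \<open>m\<close>,
  hence a delayed value obeys the same bound as the current one. The alternative
  \<open>u m = 0\<close> is for delays that reach into the exactly known history.\<close>

lemma discrete_gronwall_delay:
  fixes v u Z R :: "nat \<Rightarrow> 'a::real_normed_vector"
  assumes "v 0 = 0" and step: "\<And>m. m < M \<Longrightarrow> v (Suc m) = v m + Z m + h *\<^sub>R R m"
    and R: "\<And>m. m < M \<Longrightarrow> norm (R m) \<le> c + K * (norm (v m) + norm (u m))"
    and u: "\<And>m. m < M \<Longrightarrow> u m = 0 \<or> (\<exists>i\<le>m. u m = v i)"
    and Z: "\<And>m. m \<le> M \<Longrightarrow> norm (\<Sum>i<m. Z i) \<le> B"
    and "h \<ge> 0" "K \<ge> 0" "c \<ge> 0" "m \<le> M"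
  shows "norm (v m) \<le> (B + real M * h * c) * exp (2 * h * K * real M)"
proof -
  define D where "D = B + real M * h * c"
  \<comment> \<open>The 2 counts the current and the delayed term. With this factor the geometric
    sum returns \<open>\<rho> ^ m - 1\<close>, and the induction closes with the same
    \<open>D\<close>.\<close>
  define \<rho> where "\<rho> = 1 + 2 * h * K"
  have "\<rho> \<ge> 1" using assms by (simp add: \<rho>_def)
  have "B \<ge> 0" using Z[of 0] by simp
  then have "D \<ge> 0" using assms by (simp add: D_def)
  have closed: "v m = (\<Sum>i<m. Z i) + h *\<^sub>R (\<Sum>i<m. R i)" if "m \<le> M" for m
    using that by (induction m) (auto simp: \<open>v 0 = 0\<close> step algebra_simps)
  have main: "norm (v m) \<le> D * \<rho> ^ m" if "m \<le> M" for m
    using that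
  proof (induction m rule: less_induct)
    case (less m)
    have Ri: "norm (R i) \<le> c + 2 * K * (D * \<rho> ^ i)" if "i < m" for i
    proof -
      have vk: "norm (v k) \<le> D * \<rho> ^ i" if "k \<le> i" for k
      proof -
        have "norm (v k) \<le> D * \<rho> ^ k" using less that \<open>i < m\<close> by simp
        also have "\<dots> \<le> D * \<rho> ^ i"
          using that \<open>\<rho> \<ge> 1\<close> \<open>D \<ge> 0\<close> by (intro mult_left_mono power_increasing) auto
        finally show ?thesis .
      qed
      have "norm (u i) \<le> D * \<rho> ^ i"
        using u[of i] vk \<open>i < m\<close> less.prems \<open>D \<ge> 0\<close> \<open>\<rho> \<ge> 1\<close> by fastforce
      then have "norm (v i) + norm (u i) \<le> 2 * (D * \<rho> ^ i)" using vk[of i] by simp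
      then have "K * (norm (v i) + norm (u i)) \<le> K * (2 * (D * \<rho> ^ i))"
        using \<open>K \<ge> 0\<close> by (rule mult_left_mono)
      then show ?thesis using R[of i] that less.prems by simp
    qed
    have geo: "2 * h * K * (\<Sum>i<m. \<rho> ^ i) = \<rho> ^ m - 1"
      using power_diff_1_eq[of \<rho> m] by (simp add: \<rho>_def)
    have "norm (v m) \<le> norm (\<Sum>i<m. Z i) + h * norm (\<Sum>i<m. R i)"
      unfolding closed[OF less.prems] using norm_triangle_ineq[of "\<Sum>i<m. Z i"] \<open>h \<ge> 0\<close>
      by (metis norm_scaleR abs_of_nonneg)
    also have "\<dots> \<le> B + h * (\<Sum>i<m. c + 2 * K * (D * \<rho> ^ i))"
      using Z less.prems \<open>h \<ge> 0\<close> Ri by (intro add_mono mult_left_mono sum_norm_le) auto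
    also have "\<dots> = B + real m * h * c + D * (2 * h * K * (\<Sum>i<m. \<rho> ^ i))"
      by (simp add: sum.distrib sum_distrib_left algebra_simps)
    also have "\<dots> \<le> D + D * (2 * h * K * (\<Sum>i<m. \<rho> ^ i))"
      unfolding D_def using less.prems assms by (intro add_mono mult_right_mono order_refl) auto
    also have "\<dots> = D * \<rho> ^ m" unfolding geo by (simp add: algebra_simps)
    finally show ?case .
  qed
  have "norm (v m) \<le> D * \<rho> ^ m" using main \<open>m \<le> M\<close> by simp
  also have "\<rho> ^ m \<le> \<rho> ^ M" using \<open>m \<le> M\<close> \<open>\<rho> \<ge> 1\<close> by (intro power_increasing)
  also have "\<rho> ^ M \<le> exp (2 * h * K) ^ M"
    using \<open>\<rho> \<ge> 1\<close> exp_ge_add_one_self[of "2 * h * K"] by (intro power_mono) (auto simp: \<rho>_def)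
  also have "\<dots> = exp (2 * h * K * real M)" by (simp add: exp_of_nat_mult[symmetric] mult.commute)
  finally show ?thesis using \<open>D \<ge> 0\<close> by (simp add: D_def mult_left_mono)
qed

section \<open>The scheme with one global step number\<close>

definition flat_euler ::
  "real \<Rightarrow> real^'d \<Rightarrow> (real \<Rightarrow> real^'d \<Rightarrow> real^'d \<Rightarrow> real^'d) \<Rightarrow> nat \<Rightarrow> (nat \<Rightarrow> nat \<Rightarrow> real) \<Rightarrow> nat \<Rightarrow> real^'d" where
  "flat_euler \<tau> x0 f N g m = euler_stage \<tau> x0 f N g (Suc (m div N)) (m mod N)"

text \<open>\<open>k = N\<close> is allowed because the last value of a stage is also the first
  value of the next one, which is how \<open>div\<close> and \<open>mod\<close> read it.\<close>

lemma euler_stage_eq_flat_euler: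
  assumes "N > 0" "k \<le> N"
  shows "euler_stage \<tau> x0 f N g (Suc j) k = flat_euler \<tau> x0 f N g (j * N + k)"
proof (cases "k = N")
  case True
  then have "(j * N + k) div N = Suc j" "(j * N + k) mod N = 0" using assms by auto
  then show ?thesis unfolding flat_euler_def using True by simp
next
  case False
  then have "(j * N + k) div N = j" "(j * N + k) mod N = k" using assms by auto
  then show ?thesis unfolding flat_euler_def by simp
qed

lemma flat_euler_0 [simp]: "flat_euler \<tau> x0 f N g 0 = x0"
  by (simp add: flat_euler_def)

text \<open>Lowering the stage by one goes back \<open>N\<close> global steps, that is, one delay;
  stage 0 is the constant history.\<close>

lemma flat_euler_delay:
  assumes "N > 0"
  shows "euler_stage \<tau> x0 f N g (m div N) (m mod N) = (if m < N then x0 else flat_euler \<tau> x0 f N g (m - N))"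
proof (cases "m < N")
  case False
  then have "m div N = Suc ((m - N) div N)" "m mod N = (m - N) mod N"
    using assms by (auto simp: le_div_geq le_mod_geq)
  then show ?thesis using False by (simp only: flat_euler_def if_False)
qed simp

lemma flat_euler_Suc:
  assumes "N > 0"
  shows "flat_euler \<tau> x0 f N g (Suc m) = flat_euler \<tau> x0 f N g m
     + (\<tau> / real N) *\<^sub>R f (grid_point \<tau> N (m div N) (m mod N) + (\<tau> / real N) * g (m div N) (Suc (m mod N)))
         (flat_euler \<tau> x0 f N g m) (if m < N then x0 else flat_euler \<tau> x0 f N g (m - N))"
proof -
  have m: "m div N * N + m mod N = m" by simp
  have "flat_euler \<tau> x0 f N g (Suc m) = euler_stage \<tau> x0 f N g (Suc (m div N)) (Suc (m mod N))"
    using euler_stage_eq_flat_euler[of N "Suc (m mod N)" \<tau> x0 f g "m div N"] assms m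
    by (simp add: Suc_leI)
  then show ?thesis
    by (simp add: flat_euler_delay[OF assms] flat_euler_def[of \<tau> x0 f N g m])
qed

lemma grid_point_eq:
  assumes "N > 0"
  shows "grid_point \<tau> N j k = real (j * N + k) * (\<tau> / real N)"
  using assms by (simp add: grid_point_def field_simps)

lemma grid_point_div_mod:
  "N > 0 \<Longrightarrow> grid_point \<tau> N (m div N) (m mod N) = real m * (\<tau> / real N)"
  by (simp only: grid_point_eq div_mult_mod_eq)

text \<open>A statement about one realization: chance enters only through \<open>B\<close> and
  through the nodes lying in \<open>G\<close>. Moving the current and the delayed solution value
  from node to grid point costs at most \<open>C * h\<close> each, whence
  \<open>2 * \<Lambda> * C * h\<close> per step; the number of steps times \<open>h\<close> is the
  fixed final time.\<close>

lemma rand_euler_error_bound: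
  fixes f :: "real \<Rightarrow> real^'d \<Rightarrow> real^'d \<Rightarrow> real^'d" and x g :: "real \<Rightarrow> real^'d"
  assumes "N > 0" "0 < \<tau>" "C \<ge> 0" "\<Lambda> \<ge> 0"
    and lip: "\<And>s t. s \<in> {-\<tau>..(real n + 1) * \<tau>} \<Longrightarrow> t \<in> {-\<tau>..(real n + 1) * \<tau>} \<Longrightarrow>
        norm (x s - x t) \<le> C * \<bar>s - t\<bar>"
    and x0: "\<And>t. t \<in> {-\<tau>..0} \<Longrightarrow> x t = x0"
    and good: "\<And>t. t \<in> G \<Longrightarrow> g t = f t (x t) (x (t - \<tau>))"
      "\<And>t x1 x2 z1 z2. t \<in> G \<Longrightarrow> norm (f t x1 z1 - f t x2 z2) \<le> \<Lambda> * (norm (x1 - x2) + norm (z1 - z2))"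
    and \<gamma>: "\<And>m. m < Suc n * N \<Longrightarrow> \<gamma> (m div N) (Suc (m mod N)) \<in> {0..1}"
    and \<theta>_def: "\<And>m. \<theta> m = grid_point \<tau> N (m div N) (m mod N) + (\<tau> / real N) * \<gamma> (m div N) (Suc (m mod N))"
    and \<theta>: "\<And>m. m < Suc n * N \<Longrightarrow> \<theta> m \<in> G"
    and B: "\<And>m. m \<le> Suc n * N \<Longrightarrow>
       norm (\<Sum>i<m. x (real (Suc i) * (\<tau> / real N)) - x (real i * (\<tau> / real N)) - (\<tau> / real N) *\<^sub>R g (\<theta> i)) \<le> B"
    and "j \<le> n" "i \<le> N"
  shows "norm (x (grid_point \<tau> N j i) - rand_euler \<tau> x0 f N \<gamma> j i)
     \<le> (B + 2 * \<Lambda> * C * ((real n + 1) * \<tau>) * (\<tau> / real N)) * exp (2 * \<Lambda> * ((real n + 1) * \<tau>))"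
proof -
  define h where "h = \<tau> / real N"
  define T where "T = (real n + 1) * \<tau>"
  define M where "M = Suc n * N"
  define Y where "Y = flat_euler \<tau> x0 f N \<gamma>"
  define Yd where "Yd m = (if m < N then x0 else Y (m - N))" for m
  define v where "v m = x (real m * h) - Y m" for m
  define u where "u m = x (real m * h - \<tau>) - Yd m" for m
  define R where "R m = g (\<theta> m) - f (\<theta> m) (Y m) (Yd m)" for m
  have h: "h > 0" "real N * h = \<tau>" "real M * h = T"
    using assms(1,2) by (auto simp: h_def M_def T_def field_simps)
  have \<theta>_eq: "\<theta> m = real m * h + h * \<gamma> (m div N) (Suc (m mod N))" for m
    by (simp only: \<theta>_def grid_point_div_mod[OF \<open>N > 0\<close>] h_def)
  have \<theta>_bounds: "real m * h \<le> \<theta> m \<and> \<theta> m \<le> real m * h + h \<and> real m * h + h \<le> T" if "m < M" for m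
  proof -
    have "real m * h + h = real (Suc m) * h" by (simp add: algebra_simps)
    also have "\<dots> \<le> real M * h" using that h(1) by (intro mult_right_mono) auto
    finally show ?thesis
      using \<gamma>[of m] that h by (simp add: \<theta>_eq M_def mult_left_le)
  qed
  have "T > 0" using assms(2) by (simp add: T_def)
  have "norm (v (j * N + i)) \<le> (B + real M * h * (2 * \<Lambda> * C * h)) * exp (2 * h * \<Lambda> * real M)"
  proof (rule discrete_gronwall_delay[where Z = "\<lambda>i. x (real (Suc i) * h) - x (real i * h) - h *\<^sub>R g (\<theta> i)" and R = R and u = u])
    show "v 0 = 0" using x0[of 0] \<open>0 < \<tau>\<close> by (simp add: v_def Y_def)
    \<comment> \<open>\<open>h *\<^sub>R g (\<theta> m)\<close> is subtracted and added: as a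
      quadrature of \<open>x'\<close> it goes into \<open>Z\<close>, and its difference from the
      slope used by the scheme is \<open>R\<close>.\<close>
    show "v (Suc m) = v m + (x (real (Suc m) * h) - x (real m * h) - h *\<^sub>R g (\<theta> m)) + h *\<^sub>R R m" for m
    proof -
      have "Y (Suc m) = Y m + h *\<^sub>R f (\<theta> m) (Y m) (Yd m)"
        unfolding Y_def flat_euler_Suc[OF \<open>N > 0\<close>] by (simp add: \<theta>_def Yd_def Y_def h_def)
      then show ?thesis by (simp add: v_def R_def algebra_simps)
    qed
    show "norm (R m) \<le> 2 * \<Lambda> * C * h + \<Lambda> * (norm (v m) + norm (u m))" if "m < M" for m
    proof -
      note b = \<theta>_bounds[OF that]
      have "0 \<le> real m * h" using h by simp
      then have mh: "- \<tau> \<le> real m * h" "0 \<le> real m * h" using \<open>0 < \<tau>\<close> by linarith+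
      have 1: "norm (x (\<theta> m) - Y m) \<le> C * h + norm (v m)"
      proof -
        have "norm (x (\<theta> m) - x (real m * h)) \<le> C * \<bar>\<theta> m - real m * h\<bar>"
          by (rule lip; unfold atLeastAtMost_iff T_def[symmetric]; use b mh in linarith)
        also have "\<dots> \<le> C * h" using b \<open>C \<ge> 0\<close> by (intro mult_left_mono) auto
        moreover have "norm (x (\<theta> m) - Y m) \<le> norm (x (\<theta> m) - x (real m * h)) + norm (v m)"
          unfolding v_def using norm_triangle_ineq[of "x (\<theta> m) - x (real m * h)" "x (real m * h) - Y m"] by simp
        ultimately show ?thesis by linarith
      qed
      have 2: "norm (x (\<theta> m - \<tau>) - Yd m) \<le> C * h + norm (u m)"
      proof -
        have "norm (x (\<theta> m - \<tau>) - x (real m * h - \<tau>)) \<le> C * \<bar>(\<theta> m - \<tau>) - (real m * h - \<tau>)\<bar>"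
          by (rule lip; unfold atLeastAtMost_iff T_def[symmetric]; use b mh \<open>0 < \<tau>\<close> in linarith)
        also have "\<dots> \<le> C * h" using b \<open>C \<ge> 0\<close> by (intro mult_left_mono) auto
        moreover have "norm (x (\<theta> m - \<tau>) - Yd m) \<le> norm (x (\<theta> m - \<tau>) - x (real m * h - \<tau>)) + norm (u m)"
          unfolding u_def
          using norm_triangle_ineq[of "x (\<theta> m - \<tau>) - x (real m * h - \<tau>)" "x (real m * h - \<tau>) - Yd m"] by simp
        ultimately show ?thesis by linarith
      qed
      have G: "\<theta> m \<in> G" using \<theta> that by (simp add: M_def)
      have "norm (R m) \<le> \<Lambda> * (norm (x (\<theta> m) - Y m) + norm (x (\<theta> m - \<tau>) - Yd m))"
        unfolding R_def good(1)[OF G] by (rule good(2)[OF G])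
      also have "\<dots> \<le> \<Lambda> * ((C * h + norm (v m)) + (C * h + norm (u m)))"
        using 1 2 \<open>\<Lambda> \<ge> 0\<close> by (intro mult_left_mono add_mono)
      finally show ?thesis by (simp add: algebra_simps)
    qed
    \<comment> \<open>For \<open>m < N\<close> the delayed time is nonpositive, so solution and
      scheme both equal \<open>x0\<close> there; afterwards the delay is exactly \<open>N\<close>
      steps and \<open>u m\<close> is an earlier \<open>v\<close>.\<close>
    show "u m = 0 \<or> (\<exists>i\<le>m. u m = v i)" if "m < M" for m
    proof (cases "m < N")
      case True
      have "real m * h \<le> real N * h" using True h by (intro mult_right_mono) auto
      then have "x (real m * h - \<tau>) = x0" using h by (intro x0) auto
      then show ?thesis using True by (simp add: u_def Yd_def)
    next
      case False
      then have "real m * h - \<tau> = real (m - N) * h"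
        using h(2) by (simp add: of_nat_diff algebra_simps)
      then show ?thesis using False by (intro disjI2 exI[of _ "m - N"]) (simp add: u_def v_def Yd_def)
    qed
    show "j * N + i \<le> M"
      using \<open>i \<le> N\<close> mult_le_mono1[OF \<open>j \<le> n\<close>, of N] by (simp only: M_def mult_Suc)
  qed (use B h assms in \<open>auto simp: M_def h_def\<close>)
  moreover have "rand_euler \<tau> x0 f N \<gamma> j i = Y (j * N + i)"
    unfolding rand_euler_def Y_def by (rule euler_stage_eq_flat_euler) fact+
  moreover have "grid_point \<tau> N j i = real (j * N + i) * h"
    unfolding h_def by (rule grid_point_eq) fact
  moreover have "real M * h * (2 * \<Lambda> * C * h) = 2 * \<Lambda> * C * T * h" "2 * h * \<Lambda> * real M = 2 * \<Lambda> * T"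
    unfolding h(3)[symmetric] by simp_all
  ultimately show ?thesis by (simp only: v_def T_def h_def)
qed

subsection \<open>Moments of the quadrature errors\<close>

text \<open>Independence factors the integral, and Hoeffding's lemma on an interval of length
  \<open>2 * c\<close> bounds each factor with the constant
  \<open>(2 * c)\<^sup>2 / 8 = c\<^sup>2 / 2\<close>.\<close>

lemma (in prob_space) nn_integral_exp_indep_sum_le:
  fixes X :: "'i \<Rightarrow> 'a \<Rightarrow> real"
  assumes "finite I" and indep: "indep_vars (\<lambda>_. borel) X I"
    and bnd: "\<And>i. i \<in> I \<Longrightarrow> AE \<omega> in M. \<bar>X i \<omega>\<bar> \<le> c"
    and mean: "\<And>i. i \<in> I \<Longrightarrow> expectation (X i) = 0" and "l > 0"
  shows "(\<integral>\<^sup>+ \<omega>. ennreal (exp (l * (\<Sum>i\<in>I. X i \<omega>))) \<partial>M) \<le> ennreal (exp (l\<^sup>2 * c\<^sup>2 / 2 * card I))"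
proof -
  have "(\<integral>\<^sup>+ \<omega>. ennreal (exp (l * (\<Sum>i\<in>I. X i \<omega>))) \<partial>M) = (\<integral>\<^sup>+ \<omega>. (\<Prod>i\<in>I. ennreal (exp (l * X i \<omega>))) \<partial>M)"
    using \<open>finite I\<close> by (simp add: prod_ennreal sum_distrib_left exp_sum)
  also have "\<dots> = (\<Prod>i\<in>I. \<integral>\<^sup>+ \<omega>. ennreal (exp (l * X i \<omega>)) \<partial>M)"
    by (intro indep_vars_nn_integral \<open>finite I\<close> indep_vars_compose2[OF indep]) auto
  also have "\<dots> \<le> (\<Prod>i\<in>I. ennreal (exp (l\<^sup>2 * c\<^sup>2 / 2)))"
  proof (rule prod_mono_ennreal)
    fix i assume i: "i \<in> I"
    have "X i \<in> borel_measurable M" using indep i by (auto simp: indep_vars_def)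
    then interpret interval_bounded_random_variable M "X i" "- c" c
      by unfold_locales (use bnd[OF i] in \<open>auto elim!: eventually_mono\<close>)
    have "(\<integral>\<^sup>+ \<omega>. ennreal (exp (l * X i \<omega>)) \<partial>M) \<le> ennreal (exp (l\<^sup>2 * (c - - c)\<^sup>2 / 8))"
      by (rule Hoeffdings_lemma_nn_integral_0[OF \<open>l > 0\<close> mean[OF i]])
    also have "(c - - c)\<^sup>2 / 8 = c\<^sup>2 / 2" by (simp add: power2_eq_square)
    then have "l\<^sup>2 * (c - - c)\<^sup>2 / 8 = l\<^sup>2 * c\<^sup>2 / 2" by simp
    finally show "(\<integral>\<^sup>+ \<omega>. ennreal (exp (l * X i \<omega>)) \<partial>M) \<le> ennreal (exp (l\<^sup>2 * c\<^sup>2 / 2))" .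
  qed
  also have "\<dots> = ennreal (exp (l\<^sup>2 * c\<^sup>2 / 2 * card I))"
    by (simp add: ennreal_power exp_of_nat_mult[symmetric] mult.commute)
  finally show ?thesis .
qed

text \<open>The exponential of an absolute value is at most the sum of the exponentials of both
  signs, and the negated variables are again independent, centred and bounded by
  \<open>c\<close>.\<close>

lemma (in prob_space) nn_integral_exp_abs_indep_sum_le:
  fixes X :: "'i \<Rightarrow> 'a \<Rightarrow> real"
  assumes "finite I" and indep: "indep_vars (\<lambda>_. borel) X I"
    and bnd: "\<And>i. i \<in> I \<Longrightarrow> AE \<omega> in M. \<bar>X i \<omega>\<bar> \<le> c"
    and mean: "\<And>i. i \<in> I \<Longrightarrow> expectation (X i) = 0" and "l > 0"
  shows "(\<integral>\<^sup>+ \<omega>. ennreal (exp (l * \<bar>\<Sum>i\<in>I. X i \<omega>\<bar>)) \<partial>M) \<le> ennreal (2 * exp (l\<^sup>2 * c\<^sup>2 / 2 * card I))"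
proof -
  have meas [measurable]: "X i \<in> borel_measurable M" if "i \<in> I" for i
    using indep that by (auto simp: indep_vars_def)
  let ?S = "\<lambda>\<omega>. \<Sum>i\<in>I. X i \<omega>"
  have "(\<integral>\<^sup>+ \<omega>. ennreal (exp (l * \<bar>?S \<omega>\<bar>)) \<partial>M)
      \<le> (\<integral>\<^sup>+ \<omega>. ennreal (exp (l * ?S \<omega>)) + ennreal (exp (l * (\<Sum>i\<in>I. - X i \<omega>))) \<partial>M)"
    by (intro nn_integral_mono) (auto simp: sum_negf abs_if simp flip: ennreal_plus intro!: ennreal_leI)
  also have "\<dots> = (\<integral>\<^sup>+ \<omega>. ennreal (exp (l * ?S \<omega>)) \<partial>M) + (\<integral>\<^sup>+ \<omega>. ennreal (exp (l * (\<Sum>i\<in>I. - X i \<omega>))) \<partial>M)"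
    by (rule nn_integral_add) measurable
  also have "\<dots> \<le> ennreal (exp (l\<^sup>2 * c\<^sup>2 / 2 * card I)) + ennreal (exp (l\<^sup>2 * c\<^sup>2 / 2 * card I))"
  proof (intro add_mono nn_integral_exp_indep_sum_le assms)
    show "indep_vars (\<lambda>_. borel) (\<lambda>i \<omega>. - X i \<omega>) I"
      by (rule indep_vars_compose2[OF indep]) simp
  qed (use bnd mean in auto)
  finally show ?thesis by (simp flip: ennreal_plus)
qed

text \<open>The \<open>L\<^sup>1\<close> variable is \<open>W = (\<Sum>N. N\<^sup>-\<^sup>3 * (\<Sum>a\<in>A N. exp (V N a)))\<close>; each summand is at
  most \<open>W\<close>, and taking logarithms turns the weight \<open>N\<^sup>3\<close> into the term \<open>3 * ln N\<close>.\<close>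
lemma (in prob_space) exp_moments_imp_log_bound:
  fixes V :: "nat \<Rightarrow> 'b \<Rightarrow> 'a \<Rightarrow> real"
  assumes meas [measurable]: "\<And>N a. N \<ge> 1 \<Longrightarrow> a \<in> A N \<Longrightarrow> V N a \<in> borel_measurable M"
    and fin: "\<And>N. finite (A N)" and card: "\<And>N. N \<ge> 1 \<Longrightarrow> real (card (A N)) \<le> r * real N"
    and mom: "\<And>N a. N \<ge> 1 \<Longrightarrow> a \<in> A N \<Longrightarrow> (\<integral>\<^sup>+ \<omega>. ennreal (exp (V N a \<omega>)) \<partial>M) \<le> ennreal B"
    and "B \<ge> 0"
  obtains W where "integrable M W" "\<And>\<omega>. W \<omega> \<ge> 0"
    "AE \<omega> in M. \<forall>N\<ge>1. \<forall>a\<in>A N. V N a \<omega> \<le> 3 * ln (real N) + ln (1 + W \<omega>)"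
proof -
  define w where "w k \<omega> = (\<Sum>a\<in>A (Suc k). ennreal (exp (V (Suc k) a \<omega>) / real (Suc k) ^ 3))" for k \<omega>
  define W' where "W' \<omega> = (\<Sum>k. w k \<omega>)" for \<omega>
  have w_meas [measurable]: "w k \<in> borel_measurable M" for k
    unfolding w_def by (intro borel_measurable_sum) simp
  have W'_meas [measurable]: "W' \<in> borel_measurable M" unfolding W'_def by measurable
  have r: "0 \<le> r" using card[of 1] of_nat_0_le_iff[of "card (A 1)"] by (simp del: of_nat_0_le_iff)
  \<comment> \<open>At most \<open>r * N\<close> terms of mean at most \<open>B / N ^ 3\<close>
    leave \<open>r * B / N ^ 2\<close>, which is summable; \<open>N = Suc k\<close> avoids division
    by zero.\<close>
  have wint: "(\<integral>\<^sup>+ \<omega>. w k \<omega> \<partial>M) \<le> ennreal (r * B * inverse (real (Suc k) ^ 2))" for k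
  proof -
    let ?n = "real (Suc k)"
    have "(\<integral>\<^sup>+ \<omega>. w k \<omega> \<partial>M) = (\<Sum>a\<in>A (Suc k). \<integral>\<^sup>+ \<omega>. ennreal (exp (V (Suc k) a \<omega>) / ?n ^ 3) \<partial>M)"
      unfolding w_def by (rule nn_integral_sum) simp
    also have "\<dots> \<le> (\<Sum>a\<in>A (Suc k). ennreal (B / ?n ^ 3))"
    proof (rule sum_mono)
      fix a assume a: "a \<in> A (Suc k)"
      have [measurable]: "V (Suc k) a \<in> borel_measurable M" using a by simp
      have "(\<integral>\<^sup>+ \<omega>. ennreal (exp (V (Suc k) a \<omega>) / ?n ^ 3) \<partial>M)
          = (\<integral>\<^sup>+ \<omega>. ennreal (inverse (?n ^ 3)) * ennreal (exp (V (Suc k) a \<omega>)) \<partial>M)"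
        by (intro nn_integral_cong) (simp add: ennreal_mult'[symmetric] field_simps del: of_nat_Suc)
      also have "\<dots> = ennreal (inverse (?n ^ 3)) * (\<integral>\<^sup>+ \<omega>. ennreal (exp (V (Suc k) a \<omega>)) \<partial>M)"
        by (rule nn_integral_cmult) measurable
      also have "\<dots> \<le> ennreal (inverse (?n ^ 3)) * ennreal B"
        using a by (intro mult_left_mono mom) auto
      also have "\<dots> = ennreal (B / ?n ^ 3)"
        using \<open>B \<ge> 0\<close> by (simp add: ennreal_mult'[symmetric] field_simps del: of_nat_Suc)
      finally show "(\<integral>\<^sup>+ \<omega>. ennreal (exp (V (Suc k) a \<omega>) / ?n ^ 3) \<partial>M) \<le> ennreal (B / ?n ^ 3)" .
    qed
    also have "\<dots> = ennreal (real (card (A (Suc k))) * (B / ?n ^ 3))"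
      by (simp only: sum_constant ennreal_mult' of_nat_0_le_iff ennreal_of_nat_eq_real_of_nat)
    also have "\<dots> \<le> ennreal (r * ?n * (B / ?n ^ 3))"
      using \<open>B \<ge> 0\<close> card[of "Suc k"] by (intro ennreal_leI mult_right_mono) auto
    also have "r * ?n * (B / ?n ^ 3) = r * B * inverse (?n ^ 2)"
      by (simp add: power2_eq_square power3_eq_cube field_simps del: of_nat_Suc)
    finally show ?thesis .
  qed
  have sm: "summable (\<lambda>k. r * B * inverse (real (Suc k) ^ 2))"
    by (intro summable_mult, subst summable_Suc_iff[of "\<lambda>k. inverse (real k ^ 2)"])
      (rule inverse_power_summable, simp)
  have "(\<integral>\<^sup>+ \<omega>. W' \<omega> \<partial>M) = (\<Sum>k. \<integral>\<^sup>+ \<omega>. w k \<omega> \<partial>M)"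
    unfolding W'_def by (rule nn_integral_suminf) measurable
  also have "\<dots> \<le> (\<Sum>k. ennreal (r * B * inverse (real (Suc k) ^ 2)))"
    by (intro suminf_le wint) auto
  also have "\<dots> < \<infinity>"
    using r \<open>B \<ge> 0\<close> sm by (subst suminf_ennreal2) (auto simp del: of_nat_Suc)
  finally have fin_int: "(\<integral>\<^sup>+ \<omega>. W' \<omega> \<partial>M) < \<infinity>" .
  then have AEfin: "AE \<omega> in M. W' \<omega> \<noteq> \<infinity>"
    by (intro nn_integral_PInf_AE) auto
  \<comment> \<open>\<open>enn2real\<close> sends infinity to 0, so comparisons with
    \<open>W\<close> are made where \<open>W'\<close> is finite, which is almost everywhere.\<close>
  define W where "W \<omega> = enn2real (W' \<omega>)" for \<omega>
  have W_nonneg: "W \<omega> \<ge> 0" for \<omega> by (simp add: W_def)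
  have "integrable M W"
  proof (rule integrableI_bounded)
    show "W \<in> borel_measurable M" unfolding W_def by measurable
    have "(\<integral>\<^sup>+ \<omega>. ennreal (norm (W \<omega>)) \<partial>M) = (\<integral>\<^sup>+ \<omega>. W' \<omega> \<partial>M)"
      using AEfin by (intro nn_integral_cong_AE) (auto elim!: eventually_mono simp: W_def less_top)
    then show "(\<integral>\<^sup>+ \<omega>. ennreal (norm (W \<omega>)) \<partial>M) < \<infinity>" using fin_int by simp
  qed
  moreover have "AE \<omega> in M. \<forall>N\<ge>1. \<forall>a\<in>A N. V N a \<omega> \<le> 3 * ln (real N) + ln (1 + W \<omega>)"
    using AEfin
  proof (eventually_elim, intro allI impI ballI)
    fix \<omega> N a assume finW: "W' \<omega> \<noteq> \<infinity>" and "1 \<le> N" and a: "a \<in> A N"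
    then obtain k where N: "N = Suc k" by (cases N) auto
    have "ennreal (exp (V N a \<omega>) / real N ^ 3) \<le> w k \<omega>"
      using a fin unfolding w_def N by (intro member_le_sum) auto
    also have "\<dots> \<le> W' \<omega>"
      unfolding W'_def by (rule order_trans[OF _ sum_le_suminf[of _ "{k}"]]) auto
    also have "\<dots> = ennreal (W \<omega>)" using finW by (simp add: W_def less_top)
    finally have "exp (V N a \<omega>) / real N ^ 3 \<le> W \<omega>" using W_nonneg by simp
    then have "exp (V N a \<omega>) \<le> real N ^ 3 * W \<omega>" using \<open>1 \<le> N\<close> by (simp add: field_simps)
    \<comment> \<open>The added 1 makes the logarithm of the random factor nonnegative.\<close>
    also have "\<dots> \<le> real N ^ 3 * (1 + W \<omega>)" by (intro mult_left_mono) auto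
    finally have "ln (exp (V N a \<omega>)) \<le> ln (real N ^ 3 * (1 + W \<omega>))"
      using \<open>1 \<le> N\<close> W_nonneg[of \<omega>] by (subst ln_le_cancel_iff) auto
    also have "\<dots> = ln (real N ^ 3) + ln (1 + W \<omega>)"
      using \<open>1 \<le> N\<close> W_nonneg[of \<omega>] by (intro ln_mult_pos) auto
    finally show "V N a \<omega> \<le> 3 * ln (real N) + ln (1 + W \<omega>)"
      using \<open>1 \<le> N\<close> by (simp add: ln_realpow)
  qed
  ultimately show thesis using that W_nonneg by blast
qed

text \<open>With \<open>y = 1 + W \<omega>\<close>, the bound
  \<open>ln y \<le> q * y powr (1 / q)\<close> makes the \<open>q\<close>-th power at most linear in
  \<open>y\<close>, so the first moment of \<open>W\<close> controls every moment of its
  logarithm.\<close>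

lemma (in prob_space) affine_ln_in_Lq:
  assumes W: "integrable M W" "\<And>\<omega>. W \<omega> \<ge> 0" and "a \<ge> 0" "b \<ge> 0" "q > 0"
  shows "(\<lambda>\<omega>. a + b * ln (1 + W \<omega>)) \<in> Lq M q"
proof -
  have [measurable]: "W \<in> borel_measurable M" using W(1) by auto
  have "integrable M (\<lambda>\<omega>. \<bar>a + b * ln (1 + W \<omega>)\<bar> powr q)"
  proof (rule Bochner_Integration.integrable_bound)
    show "integrable M (\<lambda>\<omega>. (a + b * q) powr q * (1 + W \<omega>))"
      using W(1) by (intro integrable_mult_right Bochner_Integration.integrable_add) auto
    show "AE \<omega> in M. norm (\<bar>a + b * ln (1 + W \<omega>)\<bar> powr q) \<le> norm ((a + b * q) powr q * (1 + W \<omega>))"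
    proof (rule AE_I2)
      fix \<omega>
      define y where "y = 1 + W \<omega>"
      have "y \<ge> 1" using W(2)[of \<omega>] by (simp add: y_def)
      have "ln y \<le> y powr (1 / q) / (1 / q)"
        using \<open>y \<ge> 1\<close> \<open>q > 0\<close> by (intro ln_powr_bound) auto
      then have ln: "ln y \<le> q * y powr (1 / q)" by (simp add: mult.commute)
      have "a * 1 + b * ln y \<le> a * y powr (1 / q) + b * (q * y powr (1 / q))"
        using assms \<open>y \<ge> 1\<close> ln by (intro add_mono mult_left_mono) (auto simp: ge_one_powr_ge_zero)
      then have "a + b * ln y \<le> (a + b * q) * y powr (1 / q)" by (simp add: algebra_simps)
      moreover have "0 \<le> a + b * ln y" using assms \<open>y \<ge> 1\<close> by simp
      ultimately have "\<bar>a + b * ln y\<bar> powr q \<le> ((a + b * q) * y powr (1 / q)) powr q"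
        using \<open>q > 0\<close> by (intro powr_mono2) auto
      also have "\<dots> = (a + b * q) powr q * y"
        using assms \<open>y \<ge> 1\<close> by (simp add: powr_mult powr_powr)
      finally show "norm (\<bar>a + b * ln (1 + W \<omega>)\<bar> powr q) \<le> norm ((a + b * q) powr q * (1 + W \<omega>))"
        using \<open>y \<ge> 1\<close> by (simp add: y_def)
    qed
  qed measurable
  then show ?thesis by (simp add: Lq_def)
qed

text \<open>Unbiasedness of the one-point estimate: \<open>s + h * U\<close> is uniform on an
  interval of length \<open>h\<close>. As \<open>g\<close> is bounded and measurable, the gauge
  integral \<open>I\<close> is also a Lebesgue integral.\<close>

lemma (in prob_space) expectation_affine_uniform:
  fixes g :: "real \<Rightarrow> real"
  assumes U [measurable]: "U \<in> borel_measurable M" and unif: "distr M borel U = uniform_measure lborel {0..1}"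
    and [measurable]: "g \<in> borel_measurable borel" and bnd: "\<And>t. \<bar>g t\<bar> \<le> C"
    and "h > 0" and int: "(g has_integral I) {s..s + h}"
  shows "expectation (\<lambda>\<omega>. h * g (s + h * U \<omega>)) = I"
proof -
  have "expectation (\<lambda>\<omega>. h * g (s + h * U \<omega>)) = (\<integral>u. h * g (s + h * u) \<partial>distr M borel U)"
    by (rule integral_distr[symmetric]) measurable
  also have "distr M borel U = density lborel (\<lambda>u. ennreal (indicator {0..1} u))"
    unfolding unif uniform_measure_def by (simp add: ennreal_indicator divide_ennreal_def)
  also have "(\<integral>u. h * g (s + h * u) \<partial>density lborel (\<lambda>u. ennreal (indicator {0..1} u)))
      = (\<integral>u. indicator {0..1} u *\<^sub>R (h * g (s + h * u)) \<partial>lborel)"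
    by (rule integral_density) auto
  also have "\<dots> = h * (\<integral>u. indicator {s..s + h} (s + h * u) * g (s + h * u) \<partial>lborel)"
    unfolding integral_mult_right_zero[symmetric] using \<open>h > 0\<close>
    by (intro Bochner_Integration.integral_cong refl)
      (simp add: indicator_def zero_le_mult_iff mult_le_cancel_left1)
  also have "\<dots> = (\<integral>t. indicator {s..s + h} t * g t \<partial>lborel)"
    using lborel_integral_real_affine[of h "\<lambda>t. indicator {s..s + h} t * g t" s] \<open>h > 0\<close> by simp
  also have "\<dots> = (LINT t : {s..s + h} | lborel. g t)" by (simp add: set_lebesgue_integral_def)
  also have "\<dots> = integral {s..s + h} g"
  proof (rule set_borel_integral_eq_integral(2))
    show "set_integrable lborel {s..s + h} g"
      unfolding set_integrable_def
      by (rule integrableI_bounded_set_indicator[where B = C]) (use bnd \<open>h > 0\<close> in auto)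
  qed
  also have "\<dots> = I" using int by (rule integral_unique)
  finally show ?thesis .
qed

text \<open>The law of \<open>s + h * U\<close> has a density and so does not charge null sets. Even
  \<open>U \<omega> \<in> {0..1}\<close> is only almost sure, since \<open>U\<close> is known
  through its law.\<close>

lemma (in prob_space) AE_affine_uniform:
  assumes U [measurable]: "U \<in> borel_measurable M" and unif: "distr M borel U = uniform_measure lborel {0..1}"
    and "h > 0" "{s..s + h} \<subseteq> A" and G: "AE t::real in lborel. t \<in> A \<longrightarrow> t \<in> G"
  shows "AE \<omega> in M. U \<omega> \<in> {0..1} \<and> s + h * U \<omega> \<in> G"
proof -
  obtain N where N: "N \<in> null_sets lborel" and sub: "\<And>t. t \<in> A - N \<Longrightarrow> t \<in> G"
    using G by (auto elim!: AE_E3)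
  have [measurable]: "N \<in> sets borel" using null_setsD2[OF N] by simp
  have "AE u in lborel. s + h * u \<notin> N"
    using \<open>h > 0\<close> AE_not_in[OF N] by (intro AE_borel_affine[where P = "\<lambda>t. t \<notin> N"]) auto
  then have "AE u in lborel. u \<in> {0..1} \<longrightarrow> u \<in> {0..1} \<and> s + h * u \<in> G"
  proof (eventually_elim, intro impI conjI)
    fix u assume "s + h * u \<notin> N" "u \<in> {0..1}"
    moreover from this have "s + h * u \<in> {s..s + h}" using \<open>h > 0\<close> by (auto simp: mult_left_le)
    ultimately show "s + h * u \<in> G" using sub \<open>{s..s + h} \<subseteq> A\<close> by blast
  qed
  then have "AE u in distr M borel U. u \<in> {0..1} \<and> s + h * u \<in> G"
    unfolding unif by (intro AE_uniform_measureI) auto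
  then show ?thesis by (rule AE_distrD[OF U])
qed

text \<open>Only the last argument will be random, so independence passes from
  \<open>\<gamma>\<close> to the errors by composition.\<close>

definition quadrature_error :: "real \<Rightarrow> nat \<Rightarrow> (real \<Rightarrow> real^'d) \<Rightarrow> (real \<Rightarrow> real^'d) \<Rightarrow> nat \<Rightarrow> real \<Rightarrow> real^'d" where
  "quadrature_error \<tau> N x g m u =
     x (real (Suc m) * (\<tau> / real N)) - x (real m * (\<tau> / real N))
     - (\<tau> / real N) *\<^sub>R g (real m * (\<tau> / real N) + \<tau> / real N * u)"

lemma borel_measurable_vec_nth [measurable (raw)]:
  fixes g :: "'a \<Rightarrow> real^'d"
  assumes "g \<in> borel_measurable M"
  shows "(\<lambda>u. g u $ i) \<in> borel_measurable M"
proof -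
  have "(\<lambda>v :: real^'d. v $ i) \<in> borel_measurable borel"
    by (intro borel_measurable_continuous_onI continuous_intros)
  then show ?thesis by (rule measurable_compose[OF assms])
qed

lemma borel_measurable_quadrature_error [measurable]:
  assumes [measurable]: "g \<in> borel_measurable borel"
  shows "quadrature_error \<tau> N x g m \<in> borel_measurable borel"
  unfolding quadrature_error_def by measurable

text \<open>In each component a summand is at most \<open>2 * h * C\<close>, half from the increment
  of \<open>x\<close> and half from the sample. With at most \<open>(n + 1) * N\<close> summands and
  \<open>h = \<tau> / N\<close>, \<open>sqrt N\<close> is the scaling at which all powers of
  \<open>N\<close> cancel in the exponent.\<close>

lemma (in prob_space) quadrature_error_exp_moment:
  fixes x g :: "real \<Rightarrow> real^'d"
  assumes iid: "iid_uniform M \<gamma>" and "0 < \<tau>" and "N > 0"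
    and g_meas [measurable]: "g \<in> borel_measurable borel" and g_bound: "\<And>t. norm (g t) \<le> C"
    and g_int: "\<And>a b. 0 \<le> a \<Longrightarrow> a \<le> b \<Longrightarrow> b \<le> (real n + 1) * \<tau> \<Longrightarrow> (g has_integral x b - x a) {a..b}"
    and m: "m \<le> Suc n * N"
  shows "(\<integral>\<^sup>+ \<omega>. ennreal (exp (sqrt (real N) *
       \<bar>(\<Sum>k<m. quadrature_error \<tau> N x g k (\<gamma> (k div N) (Suc (k mod N)) \<omega>)) $ i\<bar>)) \<partial>M)
     \<le> ennreal (2 * exp (2 * \<tau>\<^sup>2 * C\<^sup>2 * (real n + 1)))"
proof -
  define h where "h = \<tau> / real N"
  define idx where "idx k = (k div N, Suc (k mod N))" for k
  \<comment> \<open>Independence is stated for pairs \<open>(j, k)\<close> with \<open>k\<close>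
    from 1 on. \<open>pos\<close> recovers the global step from such a pair, which also makes
    \<open>idx\<close> injective; the \<open>- 1\<close> undoes the shift in
    \<open>k\<close>.\<close>
  define pos where "pos p = fst p * N + (snd p - 1)" for p :: "nat \<times> nat"
  have pos_idx [simp]: "pos (idx k) = k" for k by (simp add: pos_def idx_def)
  have inj: "inj_on idx {..<m}" by (rule inj_on_inverseI[of _ pos]) simp
  define X where "X p \<omega> = quadrature_error \<tau> N x g (pos p) (case_prod \<gamma> p \<omega>) $ i" for p \<omega>
  have "h > 0" "real N * h = \<tau>" using \<open>0 < \<tau>\<close> \<open>N > 0\<close> by (auto simp: h_def)
  have "C \<ge> 0" using order_trans[OF norm_ge_zero g_bound] .
  have indep\<gamma>: "indep_vars (\<lambda>_. borel) (case_prod \<gamma>) (idx ` {..<m})"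
    using iid unfolding iid_uniform_def
    by (elim conjE indep_vars_subset) (auto simp: idx_def)
  have le_T: "real (Suc k) * h \<le> (real n + 1) * \<tau>" if "k < m" for k
  proof -
    have "real (Suc k) * h \<le> real (Suc n * N) * h"
      using less_le_trans[OF that m] \<open>h > 0\<close> by (intro mult_right_mono of_nat_mono Suc_leI) auto
    also have "\<dots> = (real n + 1) * \<tau>" unfolding \<open>real N * h = \<tau>\<close>[symmetric] by (simp add: algebra_simps)
    finally show ?thesis .
  qed
  have g_int': "(g has_integral x (real (Suc k) * h) - x (real k * h)) {real k * h..real k * h + h}" if "k < m" for k
    using g_int[OF _ _ le_T[OF that], of "real k * h"] \<open>h > 0\<close> by (simp add: algebra_simps)
  have "(\<integral>\<^sup>+ \<omega>. ennreal (exp (sqrt (real N) * \<bar>\<Sum>p\<in>idx ` {..<m}. X p \<omega>\<bar>)) \<partial>M)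
      \<le> ennreal (2 * exp ((sqrt (real N))\<^sup>2 * (2 * h * C)\<^sup>2 / 2 * card (idx ` {..<m})))"
  proof (rule nn_integral_exp_abs_indep_sum_le)
    show "indep_vars (\<lambda>_. borel) X (idx ` {..<m})"
      unfolding X_def by (rule indep_vars_compose2[OF indep\<gamma>]) measurable
    fix p assume "p \<in> idx ` {..<m}"
    then obtain k where k: "p = idx k" "k < m" by auto
    let ?U = "\<gamma> (k div N) (Suc (k mod N))"
    have U [measurable]: "?U \<in> borel_measurable M"
      using indep\<gamma> k by (auto simp: indep_vars_def idx_def)
    have unif: "distr M borel ?U = uniform_measure lborel {0..1}"
      using iid by (simp add: iid_uniform_def)
    have X: "X p \<omega> = (x (real (Suc k) * h) - x (real k * h)) $ i - h * (g (real k * h + h * ?U \<omega>) $ i)" for \<omega>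
      by (simp add: X_def k quadrature_error_def h_def) (simp add: idx_def)
    have g_i: "\<bar>g t $ i\<bar> \<le> C" for t using component_le_norm_cart[of "g t" i] g_bound[of t] by simp
    have "norm (x (real (Suc k) * h) - x (real k * h)) \<le> C * h"
      using has_integral_bound_real[OF \<open>C \<ge> 0\<close> finite.emptyI g_int'[OF \<open>k < m\<close>]] g_bound \<open>h > 0\<close> by simp
    then have inc: "\<bar>(x (real (Suc k) * h) - x (real k * h)) $ i\<bar> \<le> C * h"
      using component_le_norm_cart order_trans by blast
    show "AE \<omega> in M. \<bar>X p \<omega>\<bar> \<le> 2 * h * C"
    proof (rule AE_I2)
      fix \<omega>
      have "\<bar>h * (g (real k * h + h * ?U \<omega>) $ i)\<bar> \<le> h * C"
        using g_i \<open>h > 0\<close> by (simp add: abs_mult)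
      then show "\<bar>X p \<omega>\<bar> \<le> 2 * h * C"
        unfolding X using inc by (simp add: algebra_simps)
    qed
    have "((\<lambda>t. g t $ i) has_integral (x (real (Suc k) * h) - x (real k * h)) $ i) {real k * h..real k * h + h}"
      using has_integral_linear[OF g_int'[OF \<open>k < m\<close>] bounded_linear_vec_nth[of i]] by (simp add: comp_def)
    then have "expectation (\<lambda>\<omega>. h * (g (real k * h + h * ?U \<omega>) $ i)) = (x (real (Suc k) * h) - x (real k * h)) $ i"
      using \<open>h > 0\<close> g_i by (intro expectation_affine_uniform[where C = C] unif U) measurable
    moreover have "integrable M (\<lambda>\<omega>. h * (g (real k * h + h * ?U \<omega>) $ i))"
    proof (rule integrable_const_bound)
      show "AE \<omega> in M. norm (h * (g (real k * h + h * ?U \<omega>) $ i)) \<le> h * C"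
        using g_i \<open>h > 0\<close> by (simp add: abs_mult)
    qed measurable
    ultimately show "expectation (X p) = 0"
      unfolding X by (subst Bochner_Integration.integral_diff) (auto simp: prob_space)
  qed (use \<open>N > 0\<close> in auto)
  also have "(\<lambda>\<omega>. \<Sum>p\<in>idx ` {..<m}. X p \<omega>) = (\<lambda>\<omega>. (\<Sum>k<m. quadrature_error \<tau> N x g k (\<gamma> (k div N) (Suc (k mod N)) \<omega>)) $ i)"
    unfolding sum.reindex[OF inj] by (simp add: X_def comp_def) (simp add: idx_def)
  also have "ennreal (2 * exp ((sqrt (real N))\<^sup>2 * (2 * h * C)\<^sup>2 / 2 * card (idx ` {..<m})))
      \<le> ennreal (2 * exp (2 * \<tau>\<^sup>2 * C\<^sup>2 * (real n + 1)))"
  proof -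
    have "(sqrt (real N))\<^sup>2 * (2 * h * C)\<^sup>2 / 2 * card (idx ` {..<m}) = 2 * real N * h\<^sup>2 * C\<^sup>2 * real m"
      by (simp add: card_image[OF inj] power2_eq_square)
    also have "\<dots> \<le> 2 * real N * h\<^sup>2 * C\<^sup>2 * real (Suc n * N)"
      using m by (intro mult_left_mono of_nat_mono) auto
    also have "\<dots> = 2 * \<tau>\<^sup>2 * C\<^sup>2 * (real n + 1)"
      unfolding \<open>real N * h = \<tau>\<close>[symmetric] by (simp add: power2_eq_square algebra_simps)
    finally show ?thesis by (simp add: ennreal_leI)
  qed
  finally show ?thesis .
qed

subsection \<open>Almost sure convergence rate\<close>

theorem proposition4p3:
  fixes n :: nat and \<tau> :: real and x0 :: "real^'d"
    and f :: "real \<Rightarrow> real^'d \<Rightarrow> real^'d \<Rightarrow> real^'d"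
    and x :: "real \<Rightarrow> real^'d"
    and M :: "'w measure" and \<gamma> :: "nat \<Rightarrow> nat \<Rightarrow> 'w \<Rightarrow> real"
  assumes "prob_space M" and "complete_measure M"
    and "iid_uniform M \<gamma>"
    and "0 < \<tau>"
    and "cond_A1 ((real n + 1) * \<tau>) f"
    and "cond_A2 ((real n + 1) * \<tau>) f"
    and "cond_A3 ((real n + 1) * \<tau>) f"
    and "dde_solution n \<tau> x0 f x"
  shows "\<forall>\<epsilon>\<in>{0<..<1/2 :: real}. \<exists>\<eta> \<in> (\<Inter>q\<in>{2..}. Lq M q).
           \<forall>N::nat. int N \<ge> \<lceil>\<tau>\<rceil> \<longrightarrow>
             (AE \<omega> in M.
                (MAX j\<in>{0..n}. MAX i\<in>{0..N}.
                   norm (x (grid_point \<tau> N j i) - rand_euler \<tau> x0 f N (\<lambda>j k. \<gamma> j k \<omega>) j i))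
                \<le> \<eta> \<omega> * real N powr (- 1/2 + \<epsilon>))"
proof
  fix \<epsilon> :: real assume "\<epsilon> \<in> {0<..<1/2}"
  then have "\<epsilon> > 0" by simp
  interpret prob_space M by fact
  define T where "T = (real n + 1) * \<tau>"
  obtain G g C \<Lambda> where "C \<ge> 0" "\<Lambda> \<ge> 0" and AE_G: "AE t in lborel. t \<in> {0..T} \<longrightarrow> t \<in> G"
    and g_meas [measurable]: "g \<in> borel_measurable borel" and "\<forall>t. norm (g t) \<le> C"
    and "\<forall>t\<in>G. g t = f t (x t) (x (t - \<tau>))"
    and "\<forall>t\<in>G. \<forall>x1 x2 z1 z2. norm (f t x1 z1 - f t x2 z2) \<le> \<Lambda> * (norm (x1 - x2) + norm (z1 - z2))"
    and "\<forall>a b. 0 \<le> a \<longrightarrow> a \<le> b \<longrightarrow> b \<le> T \<longrightarrow> (g has_integral x b - x a) {a..b}"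
    and "\<forall>s\<in>{-\<tau>..T}. \<forall>t\<in>{-\<tau>..T}. norm (x s - x t) \<le> C * \<bar>s - t\<bar>"
    by (rule dde_solution_regularity[OF T_def assms(4) assms(5-7)[folded T_def] assms(8)])
  then have g_bound: "\<And>t. norm (g t) \<le> C"
    and g_eq: "\<And>t. t \<in> G \<Longrightarrow> g t = f t (x t) (x (t - \<tau>))"
    and f_lip: "\<And>t x1 x2 z1 z2. t \<in> G \<Longrightarrow> norm (f t x1 z1 - f t x2 z2) \<le> \<Lambda> * (norm (x1 - x2) + norm (z1 - z2))"
    and g_int: "\<And>a b. 0 \<le> a \<Longrightarrow> a \<le> b \<Longrightarrow> b \<le> T \<Longrightarrow> (g has_integral x b - x a) {a..b}"
    and lip: "\<And>s t. s \<in> {-\<tau>..T} \<Longrightarrow> t \<in> {-\<tau>..T} \<Longrightarrow> norm (x s - x t) \<le> C * \<bar>s - t\<bar>"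
    by blast+
  have x0: "x t = x0" if "t \<in> {-\<tau>..0}" for t
    using assms(8) that by (simp add: dde_solution_def)
  have \<gamma>_meas [measurable]: "\<gamma> j (Suc k) \<in> borel_measurable M" for j k
    using assms(3) by (auto simp: iid_uniform_def indep_vars_def)
  define S where "S N m \<omega> = (\<Sum>k<m. quadrature_error \<tau> N x g k (\<gamma> (k div N) (Suc (k mod N)) \<omega>))" for N m \<omega>
  define A where "A N = {..Suc n * N} \<times> (UNIV :: 'd set)" for N
  have S_meas: "(\<lambda>\<omega>. S N m \<omega> $ i) \<in> borel_measurable M" for N m i
    unfolding S_def sum_component by measurable
  obtain W where W: "integrable M W" "\<And>\<omega>. W \<omega> \<ge> 0"
    and W_bound: "AE \<omega> in M. \<forall>N\<ge>1. \<forall>a\<in>A N.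
        sqrt (real N) * \<bar>S N (fst a) \<omega> $ snd a\<bar> \<le> 3 * ln (real N) + ln (1 + W \<omega>)"
  proof (rule exp_moments_imp_log_bound)
    fix N :: nat and a assume "1 \<le> N" and a: "a \<in> A N"
    show "(\<lambda>\<omega>. sqrt (real N) * \<bar>S N (fst a) \<omega> $ snd a\<bar>) \<in> borel_measurable M"
      using S_meas by (intro borel_measurable_times borel_measurable_abs) auto
    show "(\<integral>\<^sup>+ \<omega>. ennreal (exp (sqrt (real N) * \<bar>S N (fst a) \<omega> $ snd a\<bar>)) \<partial>M)
        \<le> ennreal (2 * exp (2 * \<tau>\<^sup>2 * C\<^sup>2 * (real n + 1)))"
      unfolding S_def using \<open>1 \<le> N\<close> a
      by (intro quadrature_error_exp_moment assms(3,4) g_bound g_int) (auto simp: A_def T_def)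
  next
    show "finite (A N)" for N by (simp add: A_def)
    \<comment> \<open>\<open>n + 2\<close> in place of \<open>n + 1\<close> absorbs the empty
      partial sum, as \<open>N\<close> is at least 1.\<close>
    show "real (card (A N)) \<le> (real n + 2) * real CARD('d) * real N" if "N \<ge> 1" for N
    proof -
      have "real (card (A N)) = (real (Suc n * N) + 1) * real CARD('d)"
        by (simp add: A_def card_cartesian_product distrib_right)
      also have "\<dots> \<le> ((real n + 2) * real N) * real CARD('d)"
        using that by (intro mult_right_mono) (auto simp: algebra_simps)
      finally show ?thesis by (simp add: mult_ac)
    qed
  qed auto
  define d where "d = real CARD('d)"
  define E where "E = exp (2 * \<Lambda> * T)"
  define \<kappa> where "\<kappa> = 2 * \<Lambda> * C * T"
  have nonneg: "d \<ge> 0" "E \<ge> 0" "\<kappa> \<ge> 0"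
    using \<open>\<Lambda> \<ge> 0\<close> \<open>C \<ge> 0\<close> assms(4) by (auto simp: d_def E_def \<kappa>_def T_def)
  \<comment> \<open>\<open>3 / \<epsilon>\<close> comes from
    \<open>ln N \<le> N powr \<epsilon> / \<epsilon>\<close>, \<open>d\<close> from bounding the
    norm by the sum of the components, \<open>\<kappa> * \<tau>\<close> from the term
    \<open>\<kappa> * h\<close>, and \<open>E\<close> from Gronwall.\<close>
  define \<eta> where "\<eta> \<omega> = E * (\<kappa> * \<tau> + 3 * d / \<epsilon>) + E * d * ln (1 + W \<omega>)" for \<omega>
  have "\<eta> \<in> (\<Inter>q\<in>{2..}. Lq M q)"
    unfolding \<eta>_def using W nonneg \<open>\<epsilon> > 0\<close> assms(4) by (auto intro!: affine_ln_in_Lq)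
  moreover have "AE \<omega> in M. (MAX j\<in>{0..n}. MAX i\<in>{0..N}.
        norm (x (grid_point \<tau> N j i) - rand_euler \<tau> x0 f N (\<lambda>j k. \<gamma> j k \<omega>) j i))
      \<le> \<eta> \<omega> * real N powr (- 1/2 + \<epsilon>)" if N: "int N \<ge> \<lceil>\<tau>\<rceil>" for N
  proof -
    have "N \<ge> 1" using N assms(4) by (cases N) (auto simp: ceiling_le_iff)
    define h where "h = \<tau> / real N"
    have h: "h > 0" "real N * h = \<tau>" using \<open>N \<ge> 1\<close> assms(4) by (auto simp: h_def)
    have grid: "grid_point \<tau> N (m div N) (m mod N) = real m * h" for m
      unfolding h_def using \<open>N \<ge> 1\<close> by (intro grid_point_div_mod) simp
    \<comment> \<open>This exceptional set may vary with \<open>N\<close>, which is fixed here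
      before "almost surely"; \<open>W\<close> was chosen once for all \<open>N\<close>.\<close>
    have "AE \<omega> in M. \<forall>m\<in>{..<Suc n * N}. \<gamma> (m div N) (Suc (m mod N)) \<omega> \<in> {0..1} \<and>
        real m * h + h * \<gamma> (m div N) (Suc (m mod N)) \<omega> \<in> G"
    proof (rule AE_finite_allI, simp)
      fix m assume "m \<in> {..<Suc n * N}"
      then have "Suc m \<le> Suc n * N" by auto
      then have "real (Suc m) * h \<le> real (Suc n * N) * h"
        using h(1) by (intro mult_right_mono of_nat_mono) auto
      also have "\<dots> = T" unfolding T_def h(2)[symmetric] by (simp add: algebra_simps)
      finally have "real m * h + h \<le> T" by (simp add: algebra_simps)
      then have "{real m * h..real m * h + h} \<subseteq> {0..T}" using h(1) by auto
      moreover have "distr M borel (\<gamma> (m div N) (Suc (m mod N))) = uniform_measure lborel {0..1}"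
        using assms(3) by (simp add: iid_uniform_def)
      ultimately show "AE \<omega> in M. \<gamma> (m div N) (Suc (m mod N)) \<omega> \<in> {0..1} \<and>
          real m * h + h * \<gamma> (m div N) (Suc (m mod N)) \<omega> \<in> G"
        using h(1) AE_G by (intro AE_affine_uniform[where A = "{0..T}"] \<gamma>_meas)
    qed
    then show ?thesis using W_bound
    proof eventually_elim
      case (elim \<omega>)
      define P where "P = real N powr \<epsilon>"
      have "P \<ge> 1" unfolding P_def using \<open>N \<ge> 1\<close> \<open>\<epsilon> > 0\<close> by (intro ge_one_powr_ge_zero) auto
      have sqrtN: "sqrt (real N) \<ge> 1" using \<open>N \<ge> 1\<close> by simp
      define B where "B = d * ((3 * ln (real N) + ln (1 + W \<omega>)) / sqrt (real N))"
      have err: "norm (x (grid_point \<tau> N j i) - rand_euler \<tau> x0 f N (\<lambda>j k. \<gamma> j k \<omega>) j i) \<le> (B + \<kappa> * h) * E"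
        if "j \<le> n" "i \<le> N" for i j
        unfolding \<kappa>_def T_def h_def E_def
      proof (rule rand_euler_error_bound[where G = G and g = g
            and \<theta> = "\<lambda>m. grid_point \<tau> N (m div N) (m mod N) + \<tau> / real N * \<gamma> (m div N) (Suc (m mod N)) \<omega>"])
        fix m assume m: "m \<le> Suc n * N"
        have sum_eq: "(\<Sum>k<m. x (real (Suc k) * (\<tau> / real N)) - x (real k * (\<tau> / real N)) - (\<tau> / real N) *\<^sub>R
            g (grid_point \<tau> N (k div N) (k mod N) + \<tau> / real N * \<gamma> (k div N) (Suc (k mod N)) \<omega>)) = S N m \<omega>"
          unfolding grid S_def quadrature_error_def h_def ..
        have "norm (S N m \<omega>) \<le> (\<Sum>i\<in>UNIV. \<bar>S N m \<omega> $ i\<bar>)" by (rule norm_le_l1_cart)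
        also have "\<dots> \<le> (\<Sum>i\<in>(UNIV :: 'd set). (3 * ln (real N) + ln (1 + W \<omega>)) / sqrt (real N))"
        proof (rule sum_mono)
          fix i :: 'd
          have "sqrt (real N) * \<bar>S N m \<omega> $ i\<bar> \<le> 3 * ln (real N) + ln (1 + W \<omega>)"
            using elim(2) \<open>N \<ge> 1\<close> m by (auto simp: A_def)
          then show "\<bar>S N m \<omega> $ i\<bar> \<le> (3 * ln (real N) + ln (1 + W \<omega>)) / sqrt (real N)"
            using sqrtN by (simp add: pos_le_divide_eq mult.commute)
        qed
        also have "\<dots> = B" by (simp add: B_def d_def)
        finally show "norm (\<Sum>k<m. x (real (Suc k) * (\<tau> / real N)) - x (real k * (\<tau> / real N)) - (\<tau> / real N) *\<^sub>R
            g (grid_point \<tau> N (k div N) (k mod N) + \<tau> / real N * \<gamma> (k div N) (Suc (k mod N)) \<omega>)) \<le> B"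
          unfolding sum_eq .
      next
        fix m assume "m < Suc n * N"
        then show "\<gamma> (m div N) (Suc (m mod N)) \<omega> \<in> {0..1}"
          "grid_point \<tau> N (m div N) (m mod N) + \<tau> / real N * \<gamma> (m div N) (Suc (m mod N)) \<omega> \<in> G"
          using elim(1) unfolding grid h_def[symmetric] by blast+
      next
        show "norm (x s - x t) \<le> C * \<bar>s - t\<bar>"
          if "s \<in> {-\<tau>..(real n + 1) * \<tau>}" "t \<in> {-\<tau>..(real n + 1) * \<tau>}" for s t
          using lip[of s t] that by (simp add: T_def)
      qed (use \<open>N \<ge> 1\<close> assms(4) \<open>C \<ge> 0\<close> \<open>\<Lambda> \<ge> 0\<close> x0 g_eq f_lip that in auto)
      have "3 * ln (real N) + ln (1 + W \<omega>) \<le> (3 / \<epsilon> + ln (1 + W \<omega>)) * P"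
      proof -
        have "ln (real N) \<le> P / \<epsilon>" unfolding P_def using \<open>N \<ge> 1\<close> \<open>\<epsilon> > 0\<close> by (intro ln_powr_bound) auto
        moreover have "ln (1 + W \<omega>) * 1 \<le> ln (1 + W \<omega>) * P"
          using \<open>P \<ge> 1\<close> W(2)[of \<omega>] by (intro mult_left_mono) auto
        moreover have "(3 / \<epsilon> + ln (1 + W \<omega>)) * P = 3 * (P / \<epsilon>) + ln (1 + W \<omega>) * P"
          by (simp add: distrib_right)
        ultimately show ?thesis by linarith
      qed
      then have "B \<le> d * ((3 / \<epsilon> + ln (1 + W \<omega>)) * P / sqrt (real N))"
        unfolding B_def using nonneg sqrtN by (intro mult_left_mono divide_right_mono) auto
      moreover have "\<kappa> * h \<le> \<kappa> * (\<tau> * P / sqrt (real N))"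
      proof -
        \<comment> \<open>The term \<open>\<kappa> * h\<close> has the better order 1/N: one factor
          \<open>1 / sqrt (real N)\<close> is given away against \<open>P \<ge> 1\<close>.\<close>
        have "1 / real N = 1 / sqrt (real N) * (1 / sqrt (real N))" by simp
        also have "\<dots> \<le> P * (1 / sqrt (real N))"
          using \<open>P \<ge> 1\<close> sqrtN by (intro mult_right_mono) (auto simp: divide_le_eq intro: order_trans)
        finally have "\<tau> * (1 / real N) \<le> \<tau> * (P * (1 / sqrt (real N)))"
          using assms(4) by (intro mult_left_mono) auto
        then show ?thesis using nonneg by (intro mult_left_mono) (auto simp: h_def)
      qed
      ultimately have "(B + \<kappa> * h) * E
          \<le> (d * ((3 / \<epsilon> + ln (1 + W \<omega>)) * P / sqrt (real N)) + \<kappa> * (\<tau> * P / sqrt (real N))) * E"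
        using nonneg by (intro mult_right_mono add_mono) auto
      also have "\<dots> = \<eta> \<omega> * (P / sqrt (real N))"
        using sqrtN \<open>\<epsilon> > 0\<close> by (simp add: \<eta>_def field_simps)
      also have "P / sqrt (real N) = real N powr (- 1/2 + \<epsilon>)"
        by (simp only: P_def powr_add powr_minus_divide powr_half_sqrt minus_divide_left[symmetric] of_nat_0_le_iff) simp
      finally have "(B + \<kappa> * h) * E \<le> \<eta> \<omega> * real N powr (- 1/2 + \<epsilon>)" .
      then show ?case
        by (subst Max_le_iff; force intro: order_trans[OF err] simp: Max_le_iff)
    qed
  qed
  ultimately show "\<exists>\<eta> \<in> (\<Inter>q\<in>{2..}. Lq M q). \<forall>N::nat. int N \<ge> \<lceil>\<tau>\<rceil> \<longrightarrow>
       (AE \<omega> in M. (MAX j\<in>{0..n}. MAX i\<in>{0..N}.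
          norm (x (grid_point \<tau> N j i) - rand_euler \<tau> x0 f N (\<lambda>j k. \<gamma> j k \<omega>) j i))
        \<le> \<eta> \<omega> * real N powr (- 1/2 + \<epsilon>))"
    by blast
qed

end
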